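(* Let $A$ be of untwisted affine type $A_r^{(1)}$, $r\ge1$, let $m\in\mathbb{Z}_{>0}$, and let $\lambda\in\Lambda^+_m$. Suppose $\mu=\lambda-\alpha_K$ and $\mu'=\lambda-\alpha_{K'}$ are two distinct cocovers of $\lambda$ in $(\Lambda^+_m,\leqslant)$, corresponding to the proper connected subdiagrams $K$ and $K'$ of $S(A)$ respectively. Then the interval $X=[\mu\wedge\mu',\lambda]$ has one of the following structures (a list of covering relations $x\twoheadrightarrow y$, meaning "$x$ covers $y$", describing the full Hasse diagram of $X$): (1) If $K$ and $K'$ satisfy one of the conditions: (a) $K$ and $K'$ are both singleton diagrams; (b) $K\cup K'$ is a disconnected subdiagram of $S(A)$; (c) $K\cup K'$ is connected and $K\cap K'\ne\emptyset$; then $X$ is a diamond: $X=\{\lambda,\mu,\mu',\mu\wedge\mu'\}$ has four elements with covering relations $\lambda\twoheadrightarrow\mu$, $\lambda\twoheadrightarrow\mu'$, $\mu\twoheadrightarrow\mu\wedge\mu'$, $\mu'\twoheadrightarrow\mu\wedge\mu'$. (2) If $K\cup K'$ is connected, $K\cap K'=\emptyset$, $|K|=1$ and $|K'|>1$, then $X$ is a pentagon: $X=\{\lambda,\mu,\nu,\mu',\mu\wedge\mu'\}$ has five elements with covering relations $\lambda\twoheadrightarrow\mu$, $\mu\twoheadrightarrow\nu$, $\nu\twoheadrightarrow\mu\wedge\mu'$, $\lambda\twoheadrightarrow\mu'$, $\mu'\twoheadrightarrow\mu\wedge\mu'$. (3) If $K\cup K'$ is connected, $K\cap K'=\emptyset$,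 $|K|>1$ and $|K'|>1$, then $X=\{\lambda,\mu,\mu',\kappa,\nu,\nu',\mu\wedge\mu'\}$ has seven elements with covering relations $\lambda\twoheadrightarrow\mu$, $\lambda\twoheadrightarrow\kappa$, $\lambda\twoheadrightarrow\mu'$, $\mu\twoheadrightarrow\nu$, $\kappa\twoheadrightarrow\nu$, $\kappa\twoheadrightarrow\nu'$, $\mu'\twoheadrightarrow\nu'$, $\nu\twoheadrightarrow\mu\wedge\mu'$, $\nu'\twoheadrightarrow\mu\wedge\mu'$.
   Context: $A$ is the generalized Cartan matrix of type $A_r^{(1)}$ (Dynkin diagram $S(A)$ a cycle on vertices $0,\dots,r$ if $r\ge2$), $\mathfrak{g}(A)$ its affine Kac-Moody algebra with Cartan subalgebra $\mathfrak{h}$, simple roots $\alpha_0,\dots,\alpha_r$, simple coroots $\alpha_0^\vee,\dots,\alpha_r^\vee$, canonical central element $c=\sum_{i=0}^r\alpha_i^\vee$, canonical imaginary root $\delta=\sum_{i=0}^r\alpha_i$. $\Lambda^+=\{\lambda\in\mathfrak{h}^*:\lambda(\alpha_i^\vee)\in\mathbb{Z}_{\ge0}\text{ for all }i\}$ is the set of dominant integral weights and $\Lambda^+_m=\{\lambda\in\Lambda^+:\lambda(c)=m\}$. The partial order is: $\mu\leqslant\lambda$ iff $\lambda-\mu$ is a non-negative integral sum of simple roots. If $\lambda$ covers $\mu$ (i.e. $\mu<\lambda$ with no element of the poset strictly between), $\mu$ is called a cocover of $\lambda$, written $\lambda\twoheadrightarrow\mu$. Each connected component of $(\Lambda^+,\leqslant)$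 is a lattice; $\mu\wedge\mu'$ denotes the greatest lower bound of $\mu$ and $\mu'$, and $[x,y]=\{z\in\Lambda^+:x\leqslant z\leqslant y\}$. For a proper connected (nonempty) subdiagram $K$ of $S(A)$ (a vertex set with the induced edges), $\alpha_K$ denotes the highest (short) root of the corresponding finite root system, which here is $\alpha_K=\sum_{i\in K}\alpha_i$. $|K|$ is the number of vertices. When $\lambda$ has two distinct cocovers, each is of the form $\lambda-\alpha_K$ for some proper connected subdiagram $K$; this is what "cocover corresponding to $K$" means.
   Formalization: Added hypothesis: if K∪K' is all of S(A), then K and K' are both singletons or |K∩K'|≥2. In the other configurations with K∪K'=S(A) the stated structure fails, e.g. r=2, λ=(1,1,1), K={0,1}, K'={1,2}, where X has five elements. *)

theory Defs
  imports Complex_Main "HOL-Algebra.Lattice" "HOL-Library.Function_Algebras"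
begin

text \<open>
  The generalized Cartan matrix \<open>A\<close> of type \<open>A\<^sub>r\<^sup>(\<^sup>1\<^sup>)\<close>, with rows and columns indexed by
  \<open>{..r}\<close>. For \<open>r = 1\<close> the two vertices of the Dynkin diagram are joined by a double bond.
\<close>

definition cartan_A1 :: "nat \<Rightarrow> nat \<Rightarrow> nat \<Rightarrow> int" where
  "cartan_A1 r i j =
     (if i = j then 2
      else if r = 1 then - 2
      else if j = (i + 1) mod (r + 1) \<or> i = (j + 1) mod (r + 1) then - 1
      else 0)"

definition dual_scale :: "complex \<Rightarrow> ('h \<Rightarrow> complex) \<Rightarrow> 'h \<Rightarrow> complex" where
  "dual_scale c f = (\<lambda>h. c * f h)"

text \<open>
  Only the Cartan subalgebra \<open>\<hh>\<close> of \<open>\<gg>(A)\<close>, with its simple roots and coroots, is needed, that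
  is, a realization of \<open>A\<close> over the complex numbers: independent coroots in \<open>\<hh>\<close>, independent
  roots in the dual of \<open>\<hh>\<close>, \<open>\<alpha>\<^sub>j(\<alpha>\<^sub>i\<^sup>\<or>) = a\<^sub>i\<^sub>j\<close>, and
  \<open>dim \<hh> = 2(r + 1) - rank A = r + 2\<close>, as \<open>A\<close> has rank \<open>r\<close>. Since \<^const>\<open>vector_space.dim\<close> is
  \<open>0\<close> for spaces of infinite dimension, the dimension condition makes \<open>\<hh>\<close> finite-dimensional.
\<close>

locale realization_A1 = vector_space scale
  for scale :: "complex \<Rightarrow> 'h::ab_group_add \<Rightarrow> 'h" +
  fixes r :: nat
    and simple_coroot :: "nat \<Rightarrow> 'h"
    and simple_root :: "nat \<Rightarrow> 'h \<Rightarrow> complex"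
  assumes dim_cartan: "dim (UNIV :: 'h set) = r + 2"
    and coroots_inj: "inj_on simple_coroot {..r}"
    and coroots_independent: "independent (simple_coroot ` {..r})"
    and roots_linear: "\<And>i. i \<le> r \<Longrightarrow> Vector_Spaces.linear scale (*) (simple_root i)"
    and roots_inj: "inj_on simple_root {..r}"
    and roots_independent: "\<not> module.dependent dual_scale (simple_root ` {..r})"
    and pairing: "\<And>i j. \<lbrakk>i \<le> r; j \<le> r\<rbrakk> \<Longrightarrow> simple_root j (simple_coroot i) = of_int (cartan_A1 r i j)"

definition central_element :: "nat \<Rightarrow> (nat \<Rightarrow> 'h::ab_group_add) \<Rightarrow> 'h" where
  "central_element r simple_coroot = (\<Sum>i\<le>r. simple_coroot i)"

definition dominant_weights ::
  "(complex \<Rightarrow> 'h::ab_group_add \<Rightarrow> 'h) \<Rightarrow> nat \<Rightarrow> (nat \<Rightarrow> 'h) \<Rightarrow> ('h \<Rightarrow> complex) set" where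
  "dominant_weights scale r simple_coroot =
     {\<Lambda>. Vector_Spaces.linear scale (*) \<Lambda> \<and> (\<forall>i\<le>r. \<Lambda> (simple_coroot i) \<in> \<nat>)}"

definition dominant_weights_level ::
  "(complex \<Rightarrow> 'h::ab_group_add \<Rightarrow> 'h) \<Rightarrow> nat \<Rightarrow> (nat \<Rightarrow> 'h) \<Rightarrow> nat \<Rightarrow> ('h \<Rightarrow> complex) set" where
  "dominant_weights_level scale r simple_coroot m =
     {\<Lambda> \<in> dominant_weights scale r simple_coroot. \<Lambda> (central_element r simple_coroot) = of_nat m}"

definition dominance_order ::
  "nat \<Rightarrow> (nat \<Rightarrow> 'h \<Rightarrow> complex) \<Rightarrow> ('h \<Rightarrow> complex) set \<Rightarrow> ('h \<Rightarrow> complex) gorder" where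
  "dominance_order r simple_root S =
     \<lparr>carrier = S, eq = (=),
      le = (\<lambda>x y. \<exists>k :: nat \<Rightarrow> nat. y - x = (\<Sum>i\<le>r. dual_scale (of_nat (k i)) (simple_root i)))\<rparr>"

definition covers :: "('a, 'b) gorder_scheme \<Rightarrow> 'a \<Rightarrow> 'a \<Rightarrow> bool" where
  "covers L x y \<longleftrightarrow> x \<in> carrier L \<and> y \<in> carrier L \<and> y \<sqsubset>\<^bsub>L\<^esub> x \<and>
     \<not> (\<exists>z\<in>carrier L. y \<sqsubset>\<^bsub>L\<^esub> z \<and> z \<sqsubset>\<^bsub>L\<^esub> x)"

text \<open>A pair \<open>(x, y)\<close> in the Hasse diagram means that \<open>x\<close> covers \<open>y\<close>.\<close>

definition hasse_diagram :: "('a, 'b) gorder_scheme \<Rightarrow> ('a \<times> 'a) set" where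
  "hasse_diagram L = {(x, y). covers L x y}"

definition dynkin_edges :: "nat \<Rightarrow> (nat \<times> nat) set" where
  "dynkin_edges r = {(i, j). i \<le> r \<and> j \<le> r \<and> i \<noteq> j \<and> cartan_A1 r i j \<noteq> 0}"

text \<open>A subdiagram is given by its vertex set and carries all induced edges.\<close>

definition connected_subdiagram :: "nat \<Rightarrow> nat set \<Rightarrow> bool" where
  "connected_subdiagram r K \<longleftrightarrow> K \<subseteq> {..r} \<and> K \<noteq> {} \<and>
     (\<forall>i\<in>K. \<forall>j\<in>K. (i, j) \<in> (dynkin_edges r \<inter> K \<times> K)\<^sup>*)"

text \<open>
  In type \<open>A\<close> the highest root of the root system of a proper connected subdiagram \<open>K\<close> is the
  sum of the simple roots of \<open>K\<close>.
\<close>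

definition highest_root :: "(nat \<Rightarrow> 'h \<Rightarrow> complex) \<Rightarrow> nat set \<Rightarrow> 'h \<Rightarrow> complex" where
  "highest_root simple_root K = (\<Sum>i\<in>K. simple_root i)"

end

theory Submission
  imports Defs
begin

text \<open>
  Since the pointwise maximum of two nonnegative root combinations \<open>k\<close> with \<open>\<Lambda> - k\<close> dominant has
  the same property, \<open>\<mu> \<and> \<mu>' = \<Lambda> - (\<Sum>i\<in>K \<union> K'. \<alpha>\<^sub>i)\<close>, so the interval consists of the weights
  \<open>\<Lambda> - (\<Sum>i\<in>S. \<alpha>\<^sub>i)\<close> with \<open>S \<subseteq> K \<union> K'\<close> good: every \<open>i \<in> S\<close> has \<open>\<Lambda>(\<alpha>\<^sub>i\<^sup>\<or>)\<close> plus the number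
  of its neighbours in \<open>S\<close> at least \<open>2\<close>. Cocovers are the minimal nonempty good sets. Such a set
  with more than one element is an arc of the cycle on which the label is \<open>1\<close> at both ends and
  \<open>0\<close> inside; a vertex of label \<open>0\<close> forces both neighbours into a good set, so a good set not
  containing the arc meets it at most in its ends, and then also contains the outer neighbours of
  those ends. This determines all good subsets of \<open>K \<union> K'\<close>.
\<close>

section \<open>Good vertex sets of a labelled cycle\<close>

text \<open>The vertices stay abstract, so that no arithmetic modulo \<open>r + 1\<close> enters the
  combinatorics. \<open>s_transitive\<close> makes a nonempty \<open>V\<close> one finite orbit of
  \<open>s\<close> and takes the place of induction around the cycle.\<close>

locale cyclic_labelling =
  fixes V :: "'v set" and s p :: "'v \<Rightarrow> 'v" and a :: "'v \<Rightarrow> nat"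
  assumes s_in: "x \<in> V \<Longrightarrow> s x \<in> V"
    and p_in: "x \<in> V \<Longrightarrow> p x \<in> V"
    and s_p: "x \<in> V \<Longrightarrow> s (p x) = x"
    and p_s: "x \<in> V \<Longrightarrow> p (s x) = x"
    and s_transitive: "\<lbrakk>C \<subseteq> V; C \<noteq> {}; \<And>x. x \<in> C \<Longrightarrow> s x \<in> C\<rbrakk> \<Longrightarrow> C = V"
begin

section \<open>Good sets and their closure properties\<close>

definition adj :: "'v \<Rightarrow> 'v \<Rightarrow> bool" where
  "adj x y \<longleftrightarrow> y = s x \<or> y = p x"

text \<open>
  For \<open>r = 1\<close> successor and predecessor coincide and the neighbour counts twice, as the double bond
  requires.
\<close>

definition good :: "'v set \<Rightarrow> bool" where
  "good S \<longleftrightarrow> S \<subseteq> V \<and> (\<forall>i\<in>S. 2 \<le> a i + of_bool (s i \<in> S) + of_bool (p i \<in> S))"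

definition minimal_good :: "'v set \<Rightarrow> bool" where
  "minimal_good K \<longleftrightarrow> good K \<and> K \<noteq> {} \<and> (\<forall>S. good S \<longrightarrow> S \<subseteq> K \<longrightarrow> S \<noteq> {} \<longrightarrow> S = K)"

text \<open>The complement of a set closed under \<open>p\<close> is closed under
  \<open>s\<close>.\<close>

lemma p_transitive:
  assumes "C \<subseteq> V" "C \<noteq> {}" "\<And>x. x \<in> C \<Longrightarrow> p x \<in> C"
  shows "C = V"
proof (rule ccontr)
  assume "C \<noteq> V"
  have "V - C = V"
  proof (rule s_transitive)
    fix x assume x: "x \<in> V - C"
    then show "s x \<in> V - C" using assms(3)[of "s x"] s_in p_s by auto
  qed (use assms(1) \<open>C \<noteq> V\<close> in auto)
  then show False using assms by auto
qed

lemma adj_sym: "x \<in> V \<Longrightarrow> adj x y \<Longrightarrow> adj y x"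
  unfolding adj_def using s_p p_s by metis

lemma goodD: "good S \<Longrightarrow> i \<in> S \<Longrightarrow> 2 \<le> a i + of_bool (s i \<in> S) + of_bool (p i \<in> S)"
  by (simp add: good_def)

lemma good_subset: "good S \<Longrightarrow> S \<subseteq> V"
  by (simp add: good_def)

text \<open>Enlarging a set can only raise the neighbour counts of its members. This is why the meet
  of two cocovers corresponds to \<open>K \<union> K'\<close>.\<close>

lemma good_Un:
  assumes "good S" "good T" shows "good (S \<union> T)"
  unfolding good_def
proof (intro conjI ballI)
  fix i assume "i \<in> S \<union> T"
  then consider "i \<in> S" | "i \<in> T" by blast
  then show "2 \<le> a i + of_bool (s i \<in> S \<union> T) + of_bool (p i \<in> S \<union> T)"
  proof cases
    case 1
    then show ?thesis using goodD[OF assms(1)] by (fastforce split: if_splits simp: of_bool_def)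
  next
    case 2
    then show ?thesis using goodD[OF assms(2)] by (fastforce split: if_splits simp: of_bool_def)
  qed
qed (use assms good_subset in auto)

lemma good_empty: "good {}"
  by (simp add: good_def)

text \<open>One neighbour in \<open>S\<close> suffices for a new vertex of positive label, and old
  members lose nothing. Together with \<open>good_pair\<close> this supplies the inner elements of
  the pentagon and of the seven-element interval.\<close>

lemma good_insert:
  assumes "good S" "e \<in> V" "1 \<le> a e" "adj e x" "x \<in> S"
  shows "good (insert e S)"
  unfolding good_def
proof (intro conjI ballI)
  fix i assume i: "i \<in> insert e S"
  show "2 \<le> a i + of_bool (s i \<in> insert e S) + of_bool (p i \<in> insert e S)"
  proof (cases "i \<in> S")
    case True
    then show ?thesis using goodD[OF assms(1), of i] by (auto split: if_splits simp: of_bool_def)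
  next
    case False
    with i have "i = e" by simp
    then show ?thesis using assms by (auto simp: adj_def of_bool_def)
  qed
qed (use assms good_subset in auto)

lemma good_pair:
  assumes "x \<in> V" "adj x y" "1 \<le> a x" "1 \<le> a y"
  shows "good {x, y}"
proof -
  have "adj y x" using assms adj_sym by blast
  moreover have "y \<in> V" using assms s_in p_in by (auto simp: adj_def)
  ultimately show ?thesis using assms by (auto simp: good_def adj_def of_bool_def)
qed

lemma full_if_closed:
  assumes "C \<subseteq> V" "C \<noteq> {}" "\<And>x y. x \<in> C \<Longrightarrow> adj x y \<Longrightarrow> y \<in> C"
  shows "C = V"
  using assms s_transitive[of C] by (auto simp: adj_def)

section \<open>Minimal good sets as singletons or arcs\<close>

lemma minimal_goodD:
  assumes "minimal_good K" "good S" "S \<subseteq> K" "S \<noteq> {}"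
  shows "S = K"
  using assms by (simp add: minimal_good_def)

lemma minimal_good_is_good: "minimal_good K \<Longrightarrow> good K"
  by (simp add: minimal_good_def)

text \<open>Start at a vertex of \<open>K\<close> with predecessor outside and follow
  \<open>s\<close> until \<open>K\<close> is first left. The vertices of this segment keep all their
  neighbours in \<open>K\<close>, so it is good, and minimality makes it all of
  \<open>K\<close>.\<close>

lemma minimal_good_arc:
  assumes K: "minimal_good K" "K \<noteq> V"
  obtains e M where "p e \<notin> K" "(s ^^ Suc M) e \<notin> K" "K = (\<lambda>t. (s ^^ t) e) ` {..M}"
    "inj_on (\<lambda>t. (s ^^ t) e) {..M}"
proof -
  have KV: "K \<subseteq> V" "K \<noteq> {}" and gK: "good K"
    using K good_subset by (auto simp: minimal_good_def)
  obtain e where e: "e \<in> K" "p e \<notin> K" using p_transitive[OF KV] K by blast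
  define f where "f t = (s ^^ t) e" for t
  have fS: "f (Suc t) = s (f t)" for t by (simp add: f_def)
  have f0: "f 0 = e" by (simp add: f_def)
  have fV: "f t \<in> V" for t by (induction t) (use e KV s_in f0 fS in auto)
  have pf: "p (f (Suc t)) = f t" for t using p_s fV fS by simp
  \<comment> \<open>A walk that never left \<open>K\<close> would sweep out a nonempty set closed
    under \<open>s\<close>, hence all of \<open>V\<close>.\<close>
  have "\<exists>n. f n \<notin> K"
  proof (rule ccontr)
    assume "\<not> ?thesis"
    then have "range f \<subseteq> K" by auto
    moreover have "range f = V"
    proof (rule s_transitive)
      fix x assume "x \<in> range f"
      then obtain t where "x = f t" by blast
      then show "s x \<in> range f" using fS[of t] by (metis rangeI)
    qed (use fV in auto)
    ultimately show False using KV K by auto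
  qed
  then obtain n where n: "f n \<notin> K" "\<And>t. t < n \<Longrightarrow> f t \<in> K"
    using exists_least_iff[of "\<lambda>n. f n \<notin> K"] by auto
  have "n \<noteq> 0" using n(1) e f0 by metis
  then obtain M where M: "n = Suc M" using not0_implies_Suc by blast
  \<comment> \<open>The bound \<open>Suc M\<close> includes the first vertex outside
    \<open>K\<close>, the successor of the last vertex of the segment.\<close>
  have inM: "f t \<in> f ` {..M} \<longleftrightarrow> f t \<in> K" if "t \<le> Suc M" for t
  proof (cases "t = Suc M")
    case True
    then show ?thesis using n M by auto
  next
    case False
    then have "t \<le> M" using that by simp
    then show ?thesis using n M by auto
  qed
  have "good (f ` {..M})"
    unfolding good_def
  proof (intro conjI ballI)
    fix i assume "i \<in> f ` {..M}"
    then obtain t where t: "t \<le> M" "i = f t" by auto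
    have "i \<in> K" using t n M by simp
    have "s i \<in> f ` {..M} \<longleftrightarrow> s i \<in> K" using inM[of "Suc t"] t fS by simp
    moreover have "p i \<in> K \<longrightarrow> p i \<in> f ` {..M}"
    proof (cases t)
      case 0
      then show ?thesis using e f0 t by simp
    next
      case (Suc u)
      then show ?thesis using t pf by auto
    qed
    ultimately show "2 \<le> a i + of_bool (s i \<in> f ` {..M}) + of_bool (p i \<in> f ` {..M})"
      using goodD[OF gK \<open>i \<in> K\<close>] by (auto simp: of_bool_def split: if_splits)
  qed (use fV in auto)
  then have Kf: "f ` {..M} = K"
    by (rule minimal_goodD[OF K(1)]) (use n M in auto)
  \<comment> \<open>Applying \<open>p\<close> reduces a coincidence to one with \<open>f 0\<close>,
    whose predecessor would then lie in \<open>K\<close>.\<close>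
  have noteq: "f t \<noteq> f u" if "t < u" "u \<le> M" for t u
    using that
  proof (induction t arbitrary: u)
    case 0
    then obtain v where v: "u = Suc v" using gr0_implies_Suc by blast
    have "f v \<in> K" using 0 v n M by simp
    moreover have "p (f 0) \<notin> K" using e f0 by simp
    ultimately show ?case using pf[of v] v by auto
  next
    case (Suc t)
    then obtain v where v: "u = Suc v" by (cases u) auto
    then have "f t \<noteq> f v" using Suc by simp
    then show ?case using pf[of t] pf[of v] v by auto
  qed
  have inj: "inj_on f {..M}"
    by (rule linorder_inj_onI) (use noteq in auto)
  have f: "(\<lambda>t. (s ^^ t) e) = f" by (simp add: f_def fun_eq_iff)
  show ?thesis
  proof (rule that[of e M])
    show "(s ^^ Suc M) e \<notin> K" using n(1) unfolding M f_def .
    show "K = (\<lambda>t. (s ^^ t) e) ` {..M}" "inj_on (\<lambda>t. (s ^^ t) e) {..M}"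
      unfolding f using Kf inj by simp_all
  qed (use e in simp)
qed

text \<open>
  The two ends \<open>e1\<close>, \<open>e2\<close> of an arc with their outer neighbours \<open>o1\<close>, \<open>o2\<close>. Orientation is
  deliberately forgotten, so that the ends can be exchanged in case distinctions.
\<close>

definition ends :: "'v set \<Rightarrow> 'v \<Rightarrow> 'v \<Rightarrow> 'v \<Rightarrow> 'v \<Rightarrow> bool" where
  "ends K e1 o1 e2 o2 \<longleftrightarrow> e1 \<in> K \<and> e2 \<in> K \<and> e1 \<noteq> e2 \<and> o1 \<notin> K \<and> o2 \<notin> K \<and>
     adj e1 o1 \<and> adj e2 o2 \<and> 1 \<le> a e1 \<and> 1 \<le> a e2 \<and>
     (\<forall>x\<in>K. \<forall>y. adj x y \<longrightarrow> y \<in> K \<or> (x = e1 \<and> y = o1) \<or> (x = e2 \<and> y = o2)) \<and>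
     (\<forall>S. good S \<longrightarrow> K \<subseteq> S \<or>
        (S \<inter> K \<subseteq> {e1, e2} \<and> (e1 \<in> S \<longrightarrow> o1 \<in> S) \<and> (e2 \<in> S \<longrightarrow> o2 \<in> S) \<and>
         (\<forall>x\<in>S \<inter> K. \<forall>y\<in>S \<inter> K. \<not> adj x y)))"

lemma ends_sym: "ends K e1 o1 e2 o2 \<Longrightarrow> ends K e2 o2 e1 o1"
  unfolding ends_def by blast

text \<open>No proper initial segment of the arc is good, which forces label 0 at inner vertices; no
  single vertex is good, which bounds all labels by 1. A good set with an inner vertex therefore
  spreads over the whole arc, and an end in a good set not containing the arc must be supported from
  outside.\<close>

lemma ends_exist:
  assumes K: "minimal_good K" "K \<noteq> V" and "\<And>i. K \<noteq> {i}"
  obtains e1 o1 e2 o2 where "ends K e1 o1 e2 o2"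
proof -
  obtain e M where e: "p e \<notin> K" and M: "(s ^^ Suc M) e \<notin> K"
    and Kf: "K = (\<lambda>t. (s ^^ t) e) ` {..M}" and inj: "inj_on (\<lambda>t. (s ^^ t) e) {..M}"
    using minimal_good_arc[OF K] by metis
  define f where "f t = (s ^^ t) e" for t
  have fS: "s (f t) = f (Suc t)" for t by (simp add: f_def)
  have f0: "f 0 = e" by (simp add: f_def)
  have Kf: "K = f ` {..M}" and inj: "inj_on f {..M}" and M: "f (Suc M) \<notin> K"
    using Kf inj M by (simp_all add: f_def[abs_def])
  have gK: "good K" and KV: "K \<subseteq> V" using K good_subset by (auto simp: minimal_good_def)
  have fK: "f t \<in> K" if "t \<le> M" for t using that Kf by auto
  have pf: "p (f (Suc t)) = f t" if "t \<le> M" for t using fS p_s fK[OF that] KV by fastforce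
  have M0: "0 < M"
  proof (rule ccontr)
    assume "\<not> 0 < M"
    then have "K = {f 0}" using Kf by auto
    then show False using assms by blast
  qed
  have pf': "p (f t) = f (t - 1)" if "0 < t" "t \<le> M" for t
    using pf[of "t - 1"] that by simp
  have a0: "1 \<le> a (f 0)" using goodD[OF gK fK[of 0]] e f0 by (auto split: if_splits simp: of_bool_def)
  have aM: "1 \<le> a (f M)" using goodD[OF gK fK[of M]] M fS by (auto split: if_splits simp: of_bool_def)
  have eqK: "u = M" if u: "u \<le> M" and g: "good (f ` {..u})" for u
  proof -
    have "f ` {..u} = K" by (rule minimal_goodD[OF K(1) g]) (use u Kf in auto)
    then have "f M \<in> f ` {..u}" using fK by blast
    then obtain v where "v \<le> u" "f M = f v" by auto
    then have "v = M" using inj_onD[OF inj, of M v] u by simp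
    then show ?thesis using \<open>v \<le> u\<close> u by simp
  qed
  have a_int: "a (f t) = 0" if t: "0 < t" "t < M" for t
  proof (rule ccontr)
    assume at: "a (f t) \<noteq> 0"
    \<comment> \<open>If the segment is cut at an inner vertex of positive label, its two ends have
      a positive label and one neighbour, and all vertices between have both neighbours.\<close>
    have "good (f ` {..t})"
      unfolding good_def
    proof (intro conjI ballI)
      fix i assume "i \<in> f ` {..t}"
      then obtain u where u: "u \<le> t" "i = f u" by auto
      have s: "s i \<in> f ` {..t}" if "u < t" using u that fS by auto
      have p: "p i \<in> f ` {..t}" if "0 < u" using pf'[OF that] u t by simp
      show "2 \<le> a i + of_bool (s i \<in> f ` {..t}) + of_bool (p i \<in> f ` {..t})"
        using s p u at a0 t by (cases "u = 0"; cases "u = t") auto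
    qed (use t fK KV in auto)
    then show False using eqK[of t] t by simp
  qed
  have a_end: "a i \<le> 1" if "i \<in> K" for i
  proof (rule ccontr)
    assume "\<not> ?thesis"
    then have "good {i}" using that KV by (auto simp: good_def)
    then have "{i} = K" by (rule minimal_goodD[OF K(1)]) (use that in auto)
    then show False using assms by blast
  qed
  have step: "f (Suc t) \<in> S \<and> f (t - 1) \<in> S" if "good S" "f t \<in> S" "0 < t" "t < M" for S t
    using goodD[OF that(1,2)] a_int that fS pf'[of t] by (auto simp: of_bool_def split: if_splits)
  have interior: "K \<subseteq> S" if S: "good S" "f t \<in> S" "0 < t" "t < M" for S t
  proof -
    have up: "t + k \<le> M \<Longrightarrow> f (t + k) \<in> S" for k
    proof (induction k)
      case (Suc k)
      then show ?case using step[of S "t + k"] S by simp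
    qed (use S in simp)
    have down: "k \<le> t \<Longrightarrow> f (t - k) \<in> S" for k
    proof (induction k)
      case (Suc k)
      then show ?case using step[of S "t - k"] S by simp
    qed (use S in simp)
    have "f u \<in> S" if "u \<le> M" for u
      using up[of "u - t"] down[of "t - u"] that by (cases "u \<le> t") auto
    then show ?thesis using Kf by auto
  qed
  \<comment> \<open>Either one of the two consecutive vertices is inner, or the arc consists of just
    these two.\<close>
  have two: "K \<subseteq> S" if S: "good S" "f t \<in> S" "f (Suc t) \<in> S" "t < M" for S t
  proof (cases "0 < t \<or> Suc t < M")
    case True
    then show ?thesis using interior[OF S(1)] S by auto
  next
    case False
    then have "t = 0" "M = 1" using S by auto
    then have "K = {f 0, f (Suc 0)}" using Kf by (auto simp: atMost_Suc)
    then show ?thesis using S \<open>t = 0\<close> by auto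
  qed
  have nbr: "y = f (Suc t) \<or> (t = 0 \<and> y = p e) \<or> (0 < t \<and> y = f (t - 1))"
    if "adj (f t) y" "t \<le> M" for t y
    using that fS pf'[of t] f0 by (cases "t = 0") (auto simp: adj_def)
  have "ends K (f 0) (p e) (f M) (f (Suc M))"
    unfolding ends_def
  proof (intro conjI ballI allI impI)
    show "f 0 \<noteq> f M" using inj M0 by (auto simp: inj_on_def)
    show "adj (f 0) (p e)" "adj (f M) (f (Suc M))" using f0 fS by (auto simp: adj_def)
  next
    fix x y assume "x \<in> K" "adj x y"
    then obtain t where t: "x = f t" "t \<le> M" using Kf by auto
    show "y \<in> K \<or> x = f 0 \<and> y = p e \<or> x = f M \<and> y = f (Suc M)"
      using nbr[of t y] t fK[of "Suc t"] fK[of "t - 1"] \<open>adj x y\<close>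
      by (metis Suc_leI diff_le_self le_neq_implies_less le_trans)
  next
    fix S assume S: "good S"
    have adj2: "K \<subseteq> S" if xy: "x \<in> S" "y \<in> S" "x \<in> K" "y \<in> K" "adj x y" for x y
    proof -
      obtain t where t: "x = f t" "t \<le> M" using Kf xy by auto
      consider "y = f (Suc t)" "t < M" | "0 < t" "y = f (t - 1)"
        using nbr[of t y] xy t e M by (metis le_neq_implies_less)
      then show ?thesis
      proof cases
        case 1
        then show ?thesis using two[OF S] t xy by auto
      next
        case 2
        then show ?thesis using two[OF S, of "t - 1"] t xy by auto
      qed
    qed
    show "K \<subseteq> S \<or> S \<inter> K \<subseteq> {f 0, f M} \<and> (f 0 \<in> S \<longrightarrow> p e \<in> S) \<and> (f M \<in> S \<longrightarrow> f (Suc M) \<in> S) \<and>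
         (\<forall>x\<in>S \<inter> K. \<forall>y\<in>S \<inter> K. \<not> adj x y)"
    proof (cases "K \<subseteq> S")
      case False
      have "t = 0 \<or> t = M" if "f t \<in> S" "t \<le> M" for t
        using interior[OF S that(1)] that False by (cases "t = 0"; cases "t = M") auto
      then have 1: "S \<inter> K \<subseteq> {f 0, f M}" using Kf by auto
      \<comment> \<open>With label at most 1, \<open>f 0\<close> needs a neighbour in
        \<open>S\<close>; the one inside the arc would force \<open>K \<subseteq> S\<close> by
        \<open>two\<close>.\<close>
      have 2: "p e \<in> S" if f: "f 0 \<in> S"
      proof (rule ccontr)
        assume "p e \<notin> S"
        then have "f (Suc 0) \<in> S" using goodD[OF S f] a_end[OF fK[of 0]] f0 fS[of 0]
          by (auto simp: of_bool_def split: if_splits)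
        then show False using two[OF S f] M0 False by auto
      qed
      have 3: "f (Suc M) \<in> S" if f: "f M \<in> S"
      proof (rule ccontr)
        assume "f (Suc M) \<notin> S"
        then have "f (M - 1) \<in> S" using goodD[OF S f] a_end[OF fK[of M]] pf'[of M] M0 fS[of M]
          by (auto simp: of_bool_def split: if_splits)
        then show False using two[OF S, of "M - 1"] f M0 False by auto
      qed
      show ?thesis using 1 2 3 adj2 False by blast
    qed simp
  qed (use fK e M a0 aM in auto)
  then show ?thesis using that by blast
qed

section \<open>Good subsets of the union of two minimal good sets\<close>

lemma good_subsets_nonadjacent:
  assumes K: "minimal_good K" and K': "minimal_good K'"
    and disj: "K \<inter> K' = {}" and nadj: "\<And>x y. x \<in> K \<Longrightarrow> y \<in> K' \<Longrightarrow> \<not> adj x y"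
  shows "{S. good S \<and> S \<subseteq> K \<union> K'} = {{}, K, K', K \<union> K'}"
proof
  have gK: "good K" "good K'" using K K' minimal_good_is_good by auto
  show "{{}, K, K', K \<union> K'} \<subseteq> {S. good S \<and> S \<subseteq> K \<union> K'}"
    using gK good_Un good_empty by auto
  have nadj': "\<not> adj y x" if "x \<in> K" "y \<in> K'" for x y
    using nadj[OF that] adj_sym that gK good_subset by blast
  \<comment> \<open>Without edges from \<open>L\<close> to \<open>L'\<close>, the neighbours in
    \<open>S\<close> of a vertex of \<open>S \<inter> L\<close> lie in \<open>L\<close>. So
    \<open>S\<close> splits into two good pieces, each empty or full by minimality.\<close>
  have part: "good (S \<inter> L)"
    if S: "good S" "S \<subseteq> L \<union> L'" and L: "\<And>x y. x \<in> L \<Longrightarrow> y \<in> L' \<Longrightarrow> \<not> adj x y" for S L L'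
    unfolding good_def
  proof (intro conjI ballI)
    fix i assume i: "i \<in> S \<inter> L"
    have "s i \<in> S \<longrightarrow> s i \<in> S \<inter> L" "p i \<in> S \<longrightarrow> p i \<in> S \<inter> L"
      using L i S by (auto simp: adj_def)
    then show "2 \<le> a i + of_bool (s i \<in> S \<inter> L) + of_bool (p i \<in> S \<inter> L)"
      using goodD[OF S(1), of i] i by (auto simp: of_bool_def split: if_splits)
  qed (use S good_subset in auto)
  show "{S. good S \<and> S \<subseteq> K \<union> K'} \<subseteq> {{}, K, K', K \<union> K'}"
  proof
    fix S assume "S \<in> {S. good S \<and> S \<subseteq> K \<union> K'}"
    then have S: "good S" "S \<subseteq> K \<union> K'" by auto
    have 1: "S \<inter> K = {} \<or> S \<inter> K = K"
      using minimal_goodD[OF K part[OF S nadj]] by blast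
    have 2: "S \<inter> K' = {} \<or> S \<inter> K' = K'"
      using minimal_goodD[OF K' part[of S K' K]] S nadj' by blast
    show "S \<in> {{}, K, K', K \<union> K'}" using 1 2 S by auto
  qed
qed

lemma good_subsets_singletons:
  assumes "good {i}" "good {j}"
  shows "{S. good S \<and> S \<subseteq> {i} \<union> {j}} = {{}, {i}, {j}, {i} \<union> {j}}"
  using assms good_Un[OF assms] good_empty by auto

lemma minimal_good_not_subset:
  assumes "minimal_good K" "minimal_good K'" "K \<noteq> K'"
  shows "\<not> K \<subseteq> K'"
  using assms minimal_goodD[OF assms(2) minimal_good_is_good[OF assms(1)]]
  by (auto simp: minimal_good_def)

text \<open>Split for citation by index: 10 controls the edges that leave the arc, 11 to 14 the good
  sets that do not contain it.\<close>

lemma endsD: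
  assumes "ends K e1 o1 e2 o2"
  shows "e1 \<in> K" "e2 \<in> K" "e1 \<noteq> e2" "o1 \<notin> K" "o2 \<notin> K"
     "adj e1 o1" "adj e2 o2" "1 \<le> a e1" "1 \<le> a e2"
     "\<And>x y. x\<in>K \<Longrightarrow> adj x y \<Longrightarrow> y \<in> K \<or> (x = e1 \<and> y = o1) \<or> (x = e2 \<and> y = o2)"
     "\<And>S. good S \<Longrightarrow> \<not> K \<subseteq> S \<Longrightarrow> S \<inter> K \<subseteq> {e1, e2}"
     "\<And>S. good S \<Longrightarrow> \<not> K \<subseteq> S \<Longrightarrow> e1 \<in> S \<Longrightarrow> o1 \<in> S"
     "\<And>S. good S \<Longrightarrow> \<not> K \<subseteq> S \<Longrightarrow> e2 \<in> S \<Longrightarrow> o2 \<in> S"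
     "\<And>S x y. good S \<Longrightarrow> \<not> K \<subseteq> S \<Longrightarrow> x \<in> S \<inter> K \<Longrightarrow> y \<in> S \<inter> K \<Longrightarrow> \<not> adj x y"
  using assms unfolding ends_def by blast+

text \<open>An edge leaves either arc only at an end, and there it enters the other arc, so the
  union is closed under adjacency.\<close>

lemma ends_meet_full:
  assumes E: "ends K e1 o1 e2 o2" and E': "ends K' e1' o1' e2' o2'"
    and V: "K \<subseteq> V" "K' \<subseteq> V"
    and "o1 \<in> K'" "o2 \<in> K'" "o1' \<in> K" "o2' \<in> K"
  shows "K \<union> K' = V"
proof (rule full_if_closed)
  fix x y assume "x \<in> K \<union> K'" "adj x y"
  then show "y \<in> K \<union> K'"
    using endsD(10)[OF E, of x y] endsD(10)[OF E', of x y] assms(5-8) by blast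
qed (use V endsD(1)[OF E] in auto)

text \<open>Neither arc contains the other, so they share only ends. A further good set could arise
  only from adjacent far ends, when the arcs close up the cycle and share a single vertex;
  \<open>wrap\<close> excludes this.\<close>

lemma good_subsets_overlap:
  assumes K: "minimal_good K" "K \<noteq> V" and K': "minimal_good K'" "K' \<noteq> V"
    and ne: "K \<noteq> K'" and meet: "K \<inter> K' \<noteq> {}"
    and wrap: "K \<union> K' = V \<Longrightarrow> 2 \<le> card (K \<inter> K')"
  shows "{S. good S \<and> S \<subseteq> K \<union> K'} = {{}, K, K', K \<union> K'}"
proof
  have gK: "good K" "good K'" using K K' minimal_good_is_good by auto
  then have V: "K \<subseteq> V" "K' \<subseteq> V" using good_subset by auto
  show "{{}, K, K', K \<union> K'} \<subseteq> {S. good S \<and> S \<subseteq> K \<union> K'}"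
    using gK good_Un good_empty by auto
  have nsub: "\<not> K \<subseteq> K'" "\<not> K' \<subseteq> K"
    using minimal_good_not_subset K K' ne by auto
  have nsing: "K \<noteq> {i}" "K' \<noteq> {i}" for i using nsub meet by auto
  \<comment> \<open>A common vertex is an end of both arcs, since each is a good set not containing
    the other; \<open>ends_sym\<close> puts it first in both.\<close>
  have "\<exists>x e2 o1 o2 e2' o1' o2'. ends K x o1 e2 o2 \<and> ends K' x o1' e2' o2'"
  proof -
    obtain e1 o1 e2 o2 where E: "ends K e1 o1 e2 o2" using ends_exist[OF K nsing(1)] by blast
    obtain e1' o1' e2' o2' where E': "ends K' e1' o1' e2' o2'" using ends_exist[OF K' nsing(2)] by blast
    have "K \<inter> K' \<subseteq> {e1, e2}" "K \<inter> K' \<subseteq> {e1', e2'}"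
      using endsD(11)[OF E gK(2) nsub(1)] endsD(11)[OF E' gK(1) nsub(2)] by auto
    then show ?thesis using meet E E' ends_sym[OF E] ends_sym[OF E'] by blast
  qed
  then obtain x e2 o1 o2 e2' o1' o2'
    where E: "ends K x o1 e2 o2" and E': "ends K' x o1' e2' o2'" by blast
  have x: "x \<in> K" "x \<in> K'" using endsD(1) E E' by auto
  have o1: "o1 \<in> K'" and o1': "o1' \<in> K"
    using endsD(12)[OF E gK(2) nsub(1)] endsD(12)[OF E' gK(1) nsub(2)] x by auto
  have int: "K \<inter> K' \<subseteq> {x, e2}" using endsD(11)[OF E gK(2) nsub(1)] by auto
  \<comment> \<open>Far ends that are each other's outer neighbours close the cycle, while
    \<open>e2 = o2'\<close> lies outside \<open>K'\<close> and leaves \<open>x\<close> as the only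
    common vertex.\<close>
  have nw: False if "o2 = e2'" "o2' = e2"
  proof -
    have "K \<union> K' = V"
      by (rule ends_meet_full[OF E E' V o1 _ o1']) (use that endsD(2) E E' in auto)
    then have "2 \<le> card (K \<inter> K')" using wrap by blast
    moreover have "e2 \<notin> K'" using endsD(5)[OF E'] that by simp
    then have "K \<inter> K' \<subseteq> {x}" using int by auto
    then have "card (K \<inter> K') \<le> 1" using card_mono[of "{x}"] by simp
    ultimately show False by simp
  qed
  \<comment> \<open>A further vertex of \<open>S\<close> can only be the far end \<open>f2'\<close>,
    which brings its outer neighbour \<open>p2'\<close> into \<open>L\<close>. The edge back to
    \<open>f2'\<close> leaves \<open>L\<close> at \<open>x\<close> or at \<open>f2\<close>: the
    former fails because \<open>x\<close> is in \<open>L'\<close> and \<open>p2'\<close> is not, the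
    latter by \<open>nwL\<close>.\<close>
  have one: "S = L"
    if S: "good S" "S \<subseteq> L \<union> L'" "L \<subseteq> S" "\<not> L' \<subseteq> S"
      and F: "ends L x p1 f2 p2" and F': "ends L' x p1' f2' p2'"
      and nwL: "p2 = f2' \<Longrightarrow> p2' = f2 \<Longrightarrow> False" and LV: "L' \<subseteq> V"
    for S L L' p1 f2 p2 p1' f2' p2'
  proof (rule ccontr)
    assume "S \<noteq> L"
    then have f2': "f2' \<in> S" "f2' \<notin> L"
      using endsD(11)[OF F' S(1,4)] S endsD(1)[OF F] by auto
    then have "p2' \<in> S" "p2' \<notin> L'"
      using endsD(13)[OF F' S(1,4)] endsD(5)[OF F'] by auto
    then have "p2' \<in> L" using S by auto
    have "adj p2' f2'" using adj_sym[OF _ endsD(7)[OF F']] endsD(2)[OF F'] LV by blast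
    then have "(p2' = x \<and> f2' = p1) \<or> (p2' = f2 \<and> f2' = p2)"
      using endsD(10)[OF F \<open>p2' \<in> L\<close>] f2' by blast
    then show False using nwL \<open>p2' \<notin> L'\<close> endsD(1)[OF F'] by blast
  qed
  \<comment> \<open>The outer neighbour \<open>p2\<close> of \<open>f2\<close> would be an end of
    \<open>L'\<close> and not \<open>x\<close>, hence \<open>f2'\<close>. Then \<open>f2\<close>,
    being adjacent to it, lies outside \<open>L'\<close> and is its outer neighbour
    \<open>p2'\<close>, against \<open>nwL\<close>.\<close>
  have none: "f2 \<notin> S"
    if S: "good S" "S \<subseteq> L \<union> L'" "\<not> L \<subseteq> S" "\<not> L' \<subseteq> S"
      and F: "ends L x p1 f2 p2" and F': "ends L' x p1' f2' p2'"
      and nwL: "p2 = f2' \<Longrightarrow> p2' = f2 \<Longrightarrow> False" and LV: "L \<subseteq> V"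
    for S L L' p1 f2 p2 p1' f2' p2'
  proof
    assume f2: "f2 \<in> S"
    then have p2: "p2 \<in> S" "p2 \<notin> L" using endsD(13)[OF F S(1,3)] endsD(5)[OF F] by auto
    then have "p2 \<in> L'" using S by auto
    then have "p2 = x \<or> p2 = f2'" using p2 endsD(11)[OF F' S(1,4)] by auto
    then have p2': "p2 = f2'" using endsD(1)[OF F] p2 by blast
    have adj: "adj p2 f2" using adj_sym[OF _ endsD(7)[OF F]] endsD(2)[OF F] LV by blast
    then have "f2 \<notin> L'" using endsD(14)[OF F' S(1,4), of p2 f2] p2 f2 \<open>p2 \<in> L'\<close> by auto
    then have "f2 = p2'" using endsD(10)[OF F' \<open>p2 \<in> L'\<close> adj] p2' endsD(3)[OF F'] by auto
    then show False using nwL p2' by blast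
  qed
  show "{S. good S \<and> S \<subseteq> K \<union> K'} \<subseteq> {{}, K, K', K \<union> K'}"
  proof
    fix S assume "S \<in> {S. good S \<and> S \<subseteq> K \<union> K'}"
    then have S: "good S" "S \<subseteq> K \<union> K'" "S \<subseteq> K' \<union> K" by auto
    consider "K \<subseteq> S" "K' \<subseteq> S" | "K \<subseteq> S" "\<not> K' \<subseteq> S" | "\<not> K \<subseteq> S" "K' \<subseteq> S"
      | "\<not> K \<subseteq> S" "\<not> K' \<subseteq> S" by blast
    then show "S \<in> {{}, K, K', K \<union> K'}"
    proof cases
      case 1
      then have "S = K \<union> K'" using S(2) by (simp add: subset_antisym)
      then show ?thesis by simp
    next
      case 2
      have "S = K" by (rule one[OF S(1,2) 2 E E' nw V(2)])
      then show ?thesis by simp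
    next
      case 3
      have "S = K'" by (rule one[OF S(1,3) 3(2,1) E' E nw V(1)])
      then show ?thesis by simp
    next
      case 4
      have "e2 \<notin> S" by (rule none[OF S(1,2) 4 E E' nw V(1)])
      moreover have "e2' \<notin> S" by (rule none[OF S(1,3) 4(2,1) E' E nw V(2)])
      \<comment> \<open>Otherwise \<open>x\<close> and \<open>o1\<close> would be adjacent vertices
        of \<open>S \<inter> K'\<close>, although \<open>S\<close> does not contain
        \<open>K'\<close>.\<close>
      moreover have "x \<notin> S"
      proof
        assume "x \<in> S"
        then have "o1 \<in> S" using endsD(12)[OF E S(1) 4(1)] by blast
        then show False
          using endsD(14)[OF E' S(1) 4(2), of x o1] endsD(6)[OF E] o1 x \<open>x \<in> S\<close> by auto
      qed
      ultimately have "S = {}"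
        using S(2) endsD(11)[OF E S(1) 4(1)] endsD(11)[OF E' S(1) 4(2)] by blast
      then show ?thesis by simp
    qed
  qed
qed

text \<open>The vertex \<open>i\<close> is the outer neighbour of the end \<open>y\<close> of
  \<open>K'\<close> but, as the cycle is not filled, not of the other end. That other end is thus
  absent from every listed set not containing \<open>K'\<close>. The witness \<open>e\<close> is
  \<open>y\<close>; \<open>e'\<close> is the other end and shows that \<open>{i, e}\<close> does not
  contain \<open>K'\<close>.\<close>

lemma good_subsets_adjacent_singleton:
  assumes K: "minimal_good {i}" and K': "minimal_good K'" "K' \<noteq> V" "\<And>j. K' \<noteq> {j}"
    and disj: "i \<notin> K'" and adj: "y \<in> K'" "adj i y"
    and nfull: "insert i K' \<noteq> V"
  obtains e e' where "e \<in> K'" "e' \<in> K'" "e \<noteq> e'"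
    "{S. good S \<and> S \<subseteq> insert i K'} = {{}, {i}, {i, e}, K', insert i K'}"
proof -
  have gK: "good {i}" "good K'" using K K' minimal_good_is_good by auto
  then have V: "i \<in> V" "K' \<subseteq> V" using good_subset by auto
  have adj': "adj y i" using adj_sym adj V by blast
  have "\<exists>e2 o2. ends K' y i e2 o2"
  proof -
    obtain e1 o1 e2 o2 where E: "ends K' e1 o1 e2 o2" using ends_exist[OF K'] by blast
    then show ?thesis using endsD(10)[OF E adj(1) adj'] disj ends_sym[OF E] by blast
  qed
  then obtain e2 o2 where E: "ends K' y i e2 o2" by blast
  have o2: "o2 \<noteq> i"
  proof
    assume o2: "o2 = i"
    have "insert i K' = V"
    proof (rule p_transitive)
      fix x assume x: "x \<in> insert i K'"
      have V': "y \<in> V" "e2 \<in> V" using endsD(1,2)[OF E] V by auto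
      show "p x \<in> insert i K'"
      proof (cases "x = i")
        case False
        then show ?thesis using endsD(10)[OF E, of x "p x"] x o2 by (auto simp: adj_def)
      next
        case True
        \<comment> \<open>If both ends lead to \<open>i\<close>, they are its two neighbours, so
          \<open>p i\<close> is one of them.\<close>
        have "y = s i \<or> y = p i" "e2 = s i \<or> e2 = p i"
          using adj endsD(7)[OF E] o2 adj_sym[OF V'(2)] by (auto simp: adj_def)
        then show ?thesis using endsD(1,2,3)[OF E] True by auto
      qed
    qed (use V in auto)
    then show False using nfull by blast
  qed
  have good_iy: "good {i, y}"
    using good_insert[OF gK(1), of y i] endsD(1,8)[OF E] V adj' by (auto simp: insert_commute)
  have "{S. good S \<and> S \<subseteq> insert i K'} = {{}, {i}, {i, y}, K', insert i K'}"
  proof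
    show "{{}, {i}, {i, y}, K', insert i K'} \<subseteq> {S. good S \<and> S \<subseteq> insert i K'}"
      using gK good_iy good_empty good_Un[OF gK] adj by auto
    show "{S. good S \<and> S \<subseteq> insert i K'} \<subseteq> {{}, {i}, {i, y}, K', insert i K'}"
    proof
      fix S assume "S \<in> {S. good S \<and> S \<subseteq> insert i K'}"
      then have S: "good S" "S \<subseteq> insert i K'" by auto
      show "S \<in> {{}, {i}, {i, y}, K', insert i K'}"
      proof (cases "K' \<subseteq> S")
        case True
        then show ?thesis using S by auto
      next
        case False
        have "e2 \<notin> S" using endsD(13)[OF E S(1) False] S(2) o2 endsD(5)[OF E] by blast
        then have "S \<subseteq> {i, y}" using endsD(11)[OF E S(1) False] S(2) by blast
        moreover have "y \<in> S \<Longrightarrow> i \<in> S" using endsD(12)[OF E S(1) False] by blast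
        ultimately have "S = {} \<or> S = {i} \<or> S = {i, y}" by auto
        then show ?thesis by auto
      qed
    qed
  qed
  then show ?thesis using that[of y e2] endsD(1,2,3)[OF E] by blast
qed

text \<open>The arcs touch at their ends \<open>x\<close> and \<open>y\<close>, and the outer
  neighbours of the far ends lie outside the union. A good subset missing part of an arc can contain
  only the touching end of that arc, and then also the touching end of the other.\<close>

lemma good_subsets_adjacent:
  assumes K: "minimal_good K" "K \<noteq> V" "\<And>j. K \<noteq> {j}"
    and K': "minimal_good K'" "K' \<noteq> V" "\<And>j. K' \<noteq> {j}"
    and disj: "K \<inter> K' = {}" and adj: "x \<in> K" "y \<in> K'" "adj x y"
    and nfull: "K \<union> K' \<noteq> V"
  obtains e e' f f' where "e \<in> K" "f \<in> K" "e \<noteq> f" "e' \<in> K'" "f' \<in> K'" "e' \<noteq> f'"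
    "{S. good S \<and> S \<subseteq> K \<union> K'} =
       {{}, K, K', {e, e'}, insert e' K, insert e K', K \<union> K'}"
proof -
  have gK: "good K" "good K'" using K K' minimal_good_is_good by auto
  then have V: "K \<subseteq> V" "K' \<subseteq> V" using good_subset by auto
  have adj': "adj y x" using adj_sym adj V by blast
  have "\<exists>e2 o2. ends K x y e2 o2"
  proof -
    obtain e1 o1 e2 o2 where E: "ends K e1 o1 e2 o2" using ends_exist[OF K] by blast
    then show ?thesis using endsD(10)[OF E adj(1,3)] disj adj ends_sym[OF E] by blast
  qed
  then obtain e2 o2 where E: "ends K x y e2 o2" by blast
  have "\<exists>e2 o2. ends K' y x e2 o2"
  proof -
    obtain e1 o1 e2 o2 where E: "ends K' e1 o1 e2 o2" using ends_exist[OF K'] by blast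
    then show ?thesis using endsD(10)[OF E adj(2) adj'] disj adj ends_sym[OF E] by blast
  qed
  then obtain e2' o2' where E': "ends K' y x e2' o2'" by blast
  \<comment> \<open>If \<open>o2\<close> is in \<open>K'\<close>, the edge from \<open>o2\<close> to
    \<open>e2\<close> leaves \<open>K'\<close>, and not through \<open>x\<close>; so
    \<open>e2\<close> is the outer neighbour \<open>o2'\<close> of the other far end.\<close>
  have o2_iff: "o2 \<in> K' \<longleftrightarrow> o2' \<in> K"
  proof
    assume o2: "o2 \<in> K'"
    have "adj o2 e2" using adj_sym[OF _ endsD(7)[OF E]] endsD(2)[OF E] V by blast
    then show "o2' \<in> K"
      using endsD(10)[OF E' o2, of e2] disj endsD(2,3)[OF E] by auto
  next
    assume o2: "o2' \<in> K"
    have "adj o2' e2'" using adj_sym[OF _ endsD(7)[OF E']] endsD(2)[OF E'] V by blast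
    then show "o2 \<in> K'"
      using endsD(10)[OF E o2, of e2'] disj endsD(2,3)[OF E'] by auto
  qed
  have "\<not> (o2 \<in> K' \<and> o2' \<in> K)"
    using ends_meet_full[OF E E' V] adj nfull by auto
  then have o2: "o2 \<notin> K \<union> K'" and o2': "o2' \<notin> K \<union> K'"
    using o2_iff endsD(5)[OF E] endsD(5)[OF E'] by blast+
  have a: "1 \<le> a x" "1 \<le> a y" using endsD(8)[OF E] endsD(8)[OF E'] .
  have xy: "good {x, y}" using good_pair[OF _ adj(3) a] adj(1) V(1) by blast
  have yK: "good (insert y K)" using good_insert[OF gK(1) _ a(2) adj' adj(1)] adj(2) V(2) by blast
  have xK': "good (insert x K')" using good_insert[OF gK(2) _ a(1) adj(3,2)] adj(1) V(1) by blast
  have "{S. good S \<and> S \<subseteq> K \<union> K'} = {{}, K, K', {x, y}, insert y K, insert x K', K \<union> K'}"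
  proof
    show "{{}, K, K', {x, y}, insert y K, insert x K', K \<union> K'} \<subseteq> {S. good S \<and> S \<subseteq> K \<union> K'}"
      using gK xy yK xK' good_empty good_Un[OF gK] adj by auto
    show "{S. good S \<and> S \<subseteq> K \<union> K'} \<subseteq> {{}, K, K', {x, y}, insert y K, insert x K', K \<union> K'}"
    proof
      fix S assume "S \<in> {S. good S \<and> S \<subseteq> K \<union> K'}"
      then have S: "good S" "S \<subseteq> K \<union> K'" by auto
      have 1: "S \<inter> K \<subseteq> {x}" "x \<in> S \<Longrightarrow> y \<in> S" if "\<not> K \<subseteq> S"
        using endsD(11,12,13)[OF E S(1) that] o2 S by blast+
      have 2: "S \<inter> K' \<subseteq> {y}" "y \<in> S \<Longrightarrow> x \<in> S" if "\<not> K' \<subseteq> S"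
        using endsD(11,12,13)[OF E' S(1) that] o2' S by blast+
      consider "K \<subseteq> S" "K' \<subseteq> S" | "K \<subseteq> S" "\<not> K' \<subseteq> S" | "\<not> K \<subseteq> S" "K' \<subseteq> S"
        | "\<not> K \<subseteq> S" "\<not> K' \<subseteq> S" by blast
      then show "S \<in> {{}, K, K', {x, y}, insert y K, insert x K', K \<union> K'}"
      proof cases
        case 1
        then show ?thesis using S by auto
      next
        case c: 2
        then have "S = K \<or> S = insert y K" using 2(1)[OF c(2)] S(2) by blast
        then show ?thesis by blast
      next
        case c: 3
        then have "S = K' \<or> S = insert x K'" using 1(1)[OF c(1)] S(2) by blast
        then show ?thesis by blast
      next
        case c: 4
        then have "S = {} \<or> S = {x, y}" using 1[OF c(1)] 2[OF c(2)] S(2) by blast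
        then show ?thesis by blast
      qed
    qed
  qed
  then show ?thesis using that[of x e2 y e2'] endsD(1,2,3)[OF E] endsD(1,2,3)[OF E'] by blast
qed

end

section \<open>Hasse diagrams of three finite posets\<close>

text \<open>Pairs point upward in inclusion: subtracting larger root sums gives smaller weights, so
  their images have the orientation of \<open>hasse_diagram\<close>.\<close>

definition covering_pairs :: "'b::order set \<Rightarrow> ('b \<times> 'b) set" where
  "covering_pairs F = {(x, y). x \<in> F \<and> y \<in> F \<and> x < y \<and> \<not> (\<exists>z\<in>F. x < z \<and> z < y)}"

lemma incomparableD:
  fixes x y :: "'b::order"
  assumes "\<not> x \<le> y" "\<not> y \<le> x"
  shows "\<not> x < y" "\<not> y < x" "x \<noteq> y" "y \<noteq> x"
  using assms by auto

lemma covering_pairs_diamond: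
  fixes a b c d :: "'b::order"
  assumes lt: "a < b" "a < c" "b < d" "c < d" and inc: "\<not> b \<le> c" "\<not> c \<le> b"
  shows "card {a, b, c, d} = 4"
    and "covering_pairs {a, b, c, d} = {(a, b), (a, c), (b, d), (c, d)}"
proof -
  have lt': "a < d" using lt(1,3) by (rule less_trans)
  note lts = lt lt'
  note neq = lts[THEN less_imp_neq] lts[THEN less_imp_neq, THEN not_sym]
  note inc' = incomparableD[OF inc]
  show "card {a, b, c, d} = 4" by (simp add: neq inc')
  show "covering_pairs {a, b, c, d} = {(a, b), (a, c), (b, d), (c, d)}"
  proof
    show "covering_pairs {a, b, c, d} \<subseteq> {(a, b), (a, c), (b, d), (c, d)}"
      unfolding covering_pairs_def
      by (rule subrelI, unfold mem_Collect_eq prod.case, elim conjE insertE emptyE;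
          simp add: lts lts[THEN less_not_sym] inc')
    show "{(a, b), (a, c), (b, d), (c, d)} \<subseteq> covering_pairs {a, b, c, d}"
      unfolding covering_pairs_def by (simp add: lts lts[THEN less_not_sym] inc')
  qed
qed

text \<open>Since \<open>b < n\<close>, the two non-relations yield \<open>\<not> c \<le> b\<close>
  and \<open>\<not> n \<le> c\<close> by transitivity.\<close>

lemma covering_pairs_pentagon:
  fixes a b n c d :: "'b::order"
  assumes lt: "a < b" "b < n" "n < d" "a < c" "c < d"
    and inc: "\<not> b \<le> c" "\<not> c \<le> n"
  shows "card {a, b, n, c, d} = 5"
    and "covering_pairs {a, b, n, c, d} = {(a, b), (b, n), (n, d), (a, c), (c, d)}"
proof -
  have lt': "a < n" "a < d" "b < d" using lt by (blast intro: less_trans)+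
  note lts = lt lt'
  note neq = lts[THEN less_imp_neq] lts[THEN less_imp_neq, THEN not_sym]
  have "\<not> c \<le> b" using inc(2) lt(2) by (meson less_imp_le order_trans)
  moreover have "\<not> n \<le> c" using inc(1) lt(2) by (meson less_imp_le order_trans)
  note inc' = incomparableD[OF inc(1) calculation] incomparableD[OF inc(2) this]
  show "card {a, b, n, c, d} = 5" by (simp add: neq inc')
  show "covering_pairs {a, b, n, c, d} = {(a, b), (b, n), (n, d), (a, c), (c, d)}"
  proof
    show "covering_pairs {a, b, n, c, d} \<subseteq> {(a, b), (b, n), (n, d), (a, c), (c, d)}"
      unfolding covering_pairs_def
      by (rule subrelI, unfold mem_Collect_eq prod.case, elim conjE insertE emptyE;
          simp add: lts lts[THEN less_not_sym] inc')
    show "{(a, b), (b, n), (n, d), (a, c), (c, d)} \<subseteq> covering_pairs {a, b, n, c, d}"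
      unfolding covering_pairs_def by (simp add: lts lts[THEN less_not_sym] inc')
  qed
qed

text \<open>The remaining non-relations follow by transitivity: for instance,
  \<open>b \<le> c\<close> would give \<open>b \<le> n'\<close>.\<close>

lemma covering_pairs_seven:
  fixes a b c k n n' d :: "'b::order"
  assumes lt: "a < b" "a < k" "a < c" "b < n" "k < n" "k < n'" "c < n'" "n < d" "n' < d"
    and inc: "\<not> b \<le> n'" "\<not> c \<le> n" "\<not> k \<le> b" "\<not> k \<le> c"
  shows "card {a, b, c, k, n, n', d} = 7"
    and "covering_pairs {a, b, c, k, n, n', d} =
      {(a, b), (a, k), (a, c), (b, n), (k, n), (k, n'), (c, n'), (n, d), (n', d)}"
proof -
  have lt': "a < n" "a < n'" "a < d" "b < d" "k < d" "c < d"
    using lt by (meson less_trans)+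
  note lts = lt lt'
  note neq = lts[THEN less_imp_neq] lts[THEN less_imp_neq, THEN not_sym]
  have bc: "\<not> b \<le> c" using inc(1) lt(7) by (meson less_imp_le order_trans)
  have cb: "\<not> c \<le> b" using inc(2) lt(4) by (meson less_imp_le order_trans)
  have bk: "\<not> b \<le> k" using inc(1) lt(6) by (meson less_imp_le order_trans)
  have ck: "\<not> c \<le> k" using inc(2) lt(5) by (meson less_imp_le order_trans)
  have n'b: "\<not> n' \<le> b" using inc(3) lt(6) by (meson less_imp_le order_trans)
  have nc: "\<not> n \<le> c" using inc(4) lt(5) by (meson less_imp_le order_trans)
  have nn': "\<not> n \<le> n'" using inc(1) lt(4) by (meson less_imp_le order_trans)
  have n'n: "\<not> n' \<le> n" using inc(2) lt(7) by (meson less_imp_le order_trans)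
  note inc' = incomparableD[OF bc cb] incomparableD[OF bk inc(3)] incomparableD[OF ck inc(4)]
    incomparableD[OF inc(1) n'b] incomparableD[OF inc(2) nc] incomparableD[OF nn' n'n]
  show "card {a, b, c, k, n, n', d} = 7" by (simp add: neq inc')
  show "covering_pairs {a, b, c, k, n, n', d} = {(a, b), (a, k), (a, c), (b, n), (k, n), (k, n'), (c, n'), (n, d), (n', d)}"
  proof
    show "covering_pairs {a, b, c, k, n, n', d} \<subseteq> {(a, b), (a, k), (a, c), (b, n), (k, n), (k, n'), (c, n'), (n, d), (n', d)}"
      unfolding covering_pairs_def
      by (rule subrelI, unfold mem_Collect_eq prod.case, elim conjE insertE emptyE;
          simp add: lts lts[THEN less_not_sym] inc')
    show "{(a, b), (a, k), (a, c), (b, n), (k, n), (k, n'), (c, n'), (n, d), (n', d)} \<subseteq> covering_pairs {a, b, c, k, n, n', d}"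
      unfolding covering_pairs_def by (simp add: lts lts[THEN less_not_sym] inc')
  qed
qed

section \<open>The affine Cartan matrix as a cycle\<close>

lemma sum_fun_apply: "(\<Sum>i\<in>S. f i) x = (\<Sum>i\<in>S. f i x)"
  by (induction S rule: infinite_finite_induct) auto

definition cyc_succ :: "nat \<Rightarrow> nat \<Rightarrow> nat" where
  "cyc_succ r i = (if i = r then 0 else i + 1)"

definition cyc_pred :: "nat \<Rightarrow> nat \<Rightarrow> nat" where
  "cyc_pred r i = (if i = 0 then r else i - 1)"

text \<open>A closed nonempty set climbs to \<open>r\<close>, passes on to 0 and climbs through
  everything.\<close>

lemma cyclic_labelling_cyc: "cyclic_labelling {..r} (cyc_succ r) (cyc_pred r)"
proof
  fix C assume C: "C \<subseteq> {..r}" "C \<noteq> {}" "\<And>x. x \<in> C \<Longrightarrow> cyc_succ r x \<in> C"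
  obtain x where x: "x \<in> C" "x \<le> r" using C by blast
  have up: "y + k \<le> r \<Longrightarrow> y \<in> C \<Longrightarrow> y + k \<in> C" for y k
  proof (induction k)
    case (Suc k)
    then show ?case using C(3)[of "y + k"] by (simp add: cyc_succ_def)
  qed simp
  have "r \<in> C" using up[of x "r - x"] x by simp
  then have "0 \<in> C" using C(3)[of r] by (simp add: cyc_succ_def)
  then show "C = {..r}" using up[of 0] C by auto
qed (auto simp: cyc_succ_def cyc_pred_def)

text \<open>For \<open>r = 1\<close> both neighbour terms apply at once and give the entry -2 of the
  double bond; for larger \<open>r\<close> the successor, the predecessor and \<open>i\<close>
  itself are distinct.\<close>

lemma cartan_A1_cyc:
  assumes "1 \<le> r" "i \<le> r" "j \<le> r"
  shows "cartan_A1 r i j = 2 * of_bool (j = i) - of_bool (j = cyc_succ r i) - of_bool (j = cyc_pred r i)"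
proof -
  have mod: "(k + 1) mod (r + 1) = cyc_succ r k" if "k \<le> r" for k
    using that by (cases "k = r") (simp_all add: cyc_succ_def)
  have pred: "i = cyc_succ r j \<longleftrightarrow> j = cyc_pred r i"
    using assms by (cases "i = 0"; cases "j = r") (auto simp: cyc_succ_def cyc_pred_def)
  show ?thesis
  proof (cases "r = 1")
    case True
    then have "i = 0 \<or> i = 1" "j = 0 \<or> j = 1" using assms by linarith+
    then show ?thesis using True
      by (elim disjE) (simp_all add: cartan_A1_def cyc_succ_def cyc_pred_def)
  next
    case False
    have "cyc_succ r i \<noteq> i" "cyc_pred r i \<noteq> i" "cyc_succ r i \<noteq> cyc_pred r i"
      using assms False unfolding cyc_succ_def cyc_pred_def by presburger+
    then show ?thesis
      using False unfolding cartan_A1_def mod[OF assms(2)] mod[OF assms(3)] pred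
      by (cases "j = i"; cases "j = cyc_succ r i"; cases "j = cyc_pred r i") simp_all
  qed
qed

lemma cyc_in: "i \<le> r \<Longrightarrow> cyc_succ r i \<le> r" "i \<le> r \<Longrightarrow> cyc_pred r i \<le> r"
  by (auto simp: cyc_succ_def cyc_pred_def)

lemma sum_cartan_A1:
  assumes "1 \<le> r" "i \<le> r" "S \<subseteq> {..r}"
  shows "(\<Sum>j\<in>S. cartan_A1 r i j) =
    2 * of_bool (i \<in> S) - of_bool (cyc_succ r i \<in> S) - of_bool (cyc_pred r i \<in> S)"
proof -
  have fin: "finite S" using assms finite_subset by blast
  have ind: "(\<Sum>j\<in>S. of_bool (j = k) :: int) = of_bool (k \<in> S)" for k
    using fin by (simp add: of_bool_def)
  have "(\<Sum>j\<in>S. cartan_A1 r i j) =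
    (\<Sum>j\<in>S. 2 * of_bool (j = i) - of_bool (j = cyc_succ r i) - of_bool (j = cyc_pred r i))"
    by (rule sum.cong) (use assms cartan_A1_cyc in auto)
  also have "\<dots> = 2 * of_bool (i \<in> S) - of_bool (cyc_succ r i \<in> S) - of_bool (cyc_pred r i \<in> S)"
    unfolding sum_subtractf ind sum_distrib_left[symmetric] ..
  finally show ?thesis .
qed

lemma cartan_A1_sym: "cartan_A1 r i j = cartan_A1 r j i"
  by (auto simp: cartan_A1_def)

lemma dynkin_edges_cyc:
  assumes "1 \<le> r"
  shows "(i, j) \<in> dynkin_edges r \<longleftrightarrow> i \<le> r \<and> j \<le> r \<and> (j = cyc_succ r i \<or> j = cyc_pred r i)"
proof -
  have "cyc_succ r i \<noteq> i" "cyc_pred r i \<noteq> i"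
    using assms by (auto simp: cyc_succ_def cyc_pred_def)
  then show ?thesis
    using cartan_A1_cyc[OF assms, of i j] by (auto simp: dynkin_edges_def of_bool_def split: if_splits)
qed

lemma dynkin_edges_sym: "(i, j) \<in> dynkin_edges r \<Longrightarrow> (j, i) \<in> dynkin_edges r"
  by (auto simp: dynkin_edges_def cartan_A1_sym)

lemma connected_subdiagram_Un_iff:
  assumes K: "connected_subdiagram r K" and K': "connected_subdiagram r K'"
  shows "connected_subdiagram r (K \<union> K') \<longleftrightarrow>
    (\<exists>x\<in>K. \<exists>y\<in>K'. x = y \<or> (x, y) \<in> dynkin_edges r)"
proof
  assume U: "connected_subdiagram r (K \<union> K')"
  obtain k k' where k: "k \<in> K" "k' \<in> K'" using K K' by (auto simp: connected_subdiagram_def)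
  have "(k, k') \<in> (dynkin_edges r \<inter> (K \<union> K') \<times> (K \<union> K'))\<^sup>*"
    using U k by (auto simp: connected_subdiagram_def)
  \<comment> \<open>Invariant along the path: either it is still in \<open>K\<close>, or it has
    already crossed into \<open>K'\<close>.\<close>
  then have "k' \<in> K \<or> (\<exists>x\<in>K. \<exists>y\<in>K'. x = y \<or> (x, y) \<in> dynkin_edges r)"
    by (induction rule: rtrancl_induct) (use k in auto)
  then show "\<exists>x\<in>K. \<exists>y\<in>K'. x = y \<or> (x, y) \<in> dynkin_edges r" using k by auto
next
  assume "\<exists>x\<in>K. \<exists>y\<in>K'. x = y \<or> (x, y) \<in> dynkin_edges r"
  then obtain x y where xy: "x \<in> K" "y \<in> K'" "x = y \<or> (x, y) \<in> dynkin_edges r" by blast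
  let ?R = "dynkin_edges r \<inter> (K \<union> K') \<times> (K \<union> K')"
  have "(x, y) \<in> ?R\<^sup>*" "(y, x) \<in> ?R\<^sup>*"
    using xy dynkin_edges_sym by auto
  moreover have "(i, j) \<in> ?R\<^sup>*" if "i \<in> K" "j \<in> K" for i j
    using that K rtrancl_mono[of "dynkin_edges r \<inter> K \<times> K" ?R] by (auto simp: connected_subdiagram_def)
  moreover have "(i, j) \<in> ?R\<^sup>*" if "i \<in> K'" "j \<in> K'" for i j
    using that K' rtrancl_mono[of "dynkin_edges r \<inter> K' \<times> K'" ?R] by (auto simp: connected_subdiagram_def)
  ultimately have "(i, j) \<in> ?R\<^sup>*" if "i \<in> K \<union> K'" "j \<in> K \<union> K'" for i j
    using that xy by (metis Un_iff rtrancl_trans)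
  then show "connected_subdiagram r (K \<union> K')"
    using K K' by (auto simp: connected_subdiagram_def)
qed

section \<open>Dominant weights below a given one\<close>

locale dominant_weight = realization_A1 +
  fixes \<Lambda> :: "'a \<Rightarrow> complex"
  assumes r_pos: "1 \<le> r"
    and dominant: "\<Lambda> \<in> dominant_weights scale r simple_coroot"
begin

definition dynkin_label :: "nat \<Rightarrow> nat" where
  "dynkin_label i = (THE n. \<Lambda> (simple_coroot i) = of_nat n)"

lemma dynkin_label:
  assumes "i \<le> r" shows "\<Lambda> (simple_coroot i) = of_nat (dynkin_label i)"
proof -
  obtain n where n: "\<Lambda> (simple_coroot i) = of_nat n"
    using dominant assms by (auto simp: dominant_weights_def Nats_def)
  then show ?thesis unfolding dynkin_label_def by simp
qed

sublocale cyclic_labelling "{..r}" "cyc_succ r" "cyc_pred r" dynkin_label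
  by (rule cyclic_labelling_cyc)

section \<open>Combinations of simple roots\<close>

sublocale dual: module dual_scale
  by standard (auto simp: dual_scale_def algebra_simps fun_eq_iff)

text \<open>Complex coefficients allow differences to be formed; nonnegative integrality enters
  through \<open>of_nat\<close>.\<close>

definition root_comb :: "(nat \<Rightarrow> complex) \<Rightarrow> 'a \<Rightarrow> complex" where
  "root_comb c = (\<Sum>i\<le>r. dual_scale (c i) (simple_root i))"

lemma root_comb_diff: "root_comb c - root_comb d = root_comb (\<lambda>i. c i - d i)"
  by (simp add: root_comb_def sum_subtractf dual.scale_left_diff_distrib)

lemma root_comb_add: "root_comb c + root_comb d = root_comb (\<lambda>i. c i + d i)"
  by (simp add: root_comb_def sum.distrib dual.scale_left_distrib)

lemma root_comb_cong: "(\<And>i. i \<le> r \<Longrightarrow> c i = d i) \<Longrightarrow> root_comb c = root_comb d"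
  by (simp add: root_comb_def)

lemma root_comb_eq_iff: "root_comb c = root_comb d \<longleftrightarrow> (\<forall>i\<le>r. c i = d i)"
proof
  assume "root_comb c = root_comb d"
  then have 0: "root_comb (\<lambda>i. c i - d i) = 0" using root_comb_diff[of c d] by simp
  \<comment> \<open>Independence is stated for the set of roots, so the coefficients are carried
    over from indices to roots, which \<open>roots_inj\<close> permits.\<close>
  define u where "u v = (let i = inv_into {..r} simple_root v in c i - d i)" for v
  have u: "u (simple_root i) = c i - d i" if "i \<le> r" for i
    using that roots_inj by (simp add: u_def Let_def inv_into_f_f)
  have "(\<Sum>v\<in>simple_root ` {..r}. dual_scale (u v) v) = root_comb (\<lambda>i. c i - d i)"
    unfolding root_comb_def by (subst sum.reindex[OF roots_inj]) (simp add: u)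
  then have z: "(\<Sum>v\<in>simple_root ` {..r}. dual_scale (u v) v) = 0" using 0 by simp
  have "u (simple_root i) = 0" if "i \<le> r" for i
    by (rule dual.independentD[OF roots_independent _ _ z]) (use that in auto)
  then show "\<forall>i\<le>r. c i = d i" using u by auto
qed (auto intro: root_comb_cong)

lemma root_comb_eqD: "root_comb c = root_comb d \<Longrightarrow> i \<le> r \<Longrightarrow> c i = d i"
  using root_comb_eq_iff by blast

lemma highest_root_comb:
  assumes "S \<subseteq> {..r}"
  shows "highest_root simple_root S = root_comb (\<lambda>i. of_bool (i \<in> S))"
proof -
  have "root_comb (\<lambda>i. of_bool (i \<in> S)) = (\<Sum>i\<in>S. dual_scale (of_bool (i \<in> S)) (simple_root i))"
    unfolding root_comb_def
    by (rule sum.mono_neutral_right) (use assms in \<open>auto simp: dual_scale_def fun_eq_iff\<close>)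
  also have "\<dots> = (\<Sum>i\<in>S. simple_root i)"
    by (rule sum.cong) (auto simp: dual_scale_def)
  finally show ?thesis by (simp add: highest_root_def)
qed

section \<open>Order and dominance of the weights \<open>wt S\<close>\<close>

abbreviation wt :: "nat set \<Rightarrow> 'a \<Rightarrow> complex" where
  "wt S \<equiv> \<Lambda> - highest_root simple_root S"

lemma le_iff: "x \<sqsubseteq>\<^bsub>dominance_order r simple_root D\<^esub> y \<longleftrightarrow> (\<exists>k. y - x = root_comb (\<lambda>i. of_nat (k i)))"
  by (simp add: dominance_order_def root_comb_def)

lemma leI: "y - x = root_comb (\<lambda>i. of_nat (k i)) \<Longrightarrow> x \<sqsubseteq>\<^bsub>dominance_order r simple_root D\<^esub> y"
  unfolding le_iff by (rule exI)

lemma leE: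
  assumes "x \<sqsubseteq>\<^bsub>dominance_order r simple_root D\<^esub> y"
  obtains k where "y - x = root_comb (\<lambda>i. of_nat (k i))"
  using assms unfolding le_iff by (elim exE)

text \<open>The natural coefficients of \<open>y - x\<close> and \<open>x - y\<close> add up to 0,
  so all of them vanish.\<close>

lemma le_antisym:
  assumes "x \<sqsubseteq>\<^bsub>dominance_order r simple_root D\<^esub> y" "y \<sqsubseteq>\<^bsub>dominance_order r simple_root D\<^esub> x"
  shows "x = y"
proof -
  obtain k l where kl: "y - x = root_comb (\<lambda>i. of_nat (k i))" "x - y = root_comb (\<lambda>i. of_nat (l i))"
    using assms leE by metis
  have "root_comb (\<lambda>i. of_nat (k i) + of_nat (l i)) = (y - x) + (x - y)"
    unfolding root_comb_add[symmetric] kl ..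
  also have "\<dots> = root_comb (\<lambda>i. 0)" by (simp add: root_comb_def)
  finally have "root_comb (\<lambda>i. of_nat (k i) + of_nat (l i)) = root_comb (\<lambda>i. 0)" .
  note sum0 = root_comb_eqD[OF this]
  have "k i = 0" if "i \<le> r" for i
  proof -
    have "of_nat (k i + l i) = (0 :: complex)" using sum0[OF that] by simp
    then have "k i + l i = 0" unfolding of_nat_eq_0_iff .
    then show ?thesis by simp
  qed
  then have "y - x = root_comb (\<lambda>i. 0)" unfolding kl by (intro root_comb_cong) simp
  then show ?thesis by (simp add: root_comb_def)
qed

lemma wt_diff:
  assumes "S \<subseteq> {..r}" "T \<subseteq> {..r}"
  shows "wt T - wt S = root_comb (\<lambda>i. of_bool (i \<in> S) - of_bool (i \<in> T))"
  using assms by (simp add: highest_root_comb root_comb_diff)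

text \<open>By independence, coefficients can be compared: a vertex of \<open>T\<close> outside
  \<open>S\<close> would demand the natural coefficient -1.\<close>

lemma wt_le_iff:
  assumes "S \<subseteq> {..r}" "T \<subseteq> {..r}"
  shows "wt S \<sqsubseteq>\<^bsub>dominance_order r simple_root D\<^esub> wt T \<longleftrightarrow> T \<subseteq> S"
proof
  assume "wt S \<sqsubseteq>\<^bsub>dominance_order r simple_root D\<^esub> wt T"
  then obtain k where "wt T - wt S = root_comb (\<lambda>i. of_nat (k i))"
    by (rule leE)
  then have "root_comb (\<lambda>i. of_bool (i \<in> S) - of_bool (i \<in> T)) = root_comb (\<lambda>i. of_nat (k i))"
    unfolding wt_diff[OF assms] .
  note k = root_comb_eqD[OF this]
  show "T \<subseteq> S"
  proof (rule subsetI, rule ccontr)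
    fix i assume i: "i \<in> T" "i \<notin> S"
    then have "i \<le> r" using assms by auto
    then have "of_nat (k i) = (- 1 :: complex)" using k[OF \<open>i \<le> r\<close>] i by simp
    then have "of_nat (k i + 1) = (0 :: complex)" by simp
    then show False unfolding of_nat_eq_0_iff by simp
  qed
next
  assume TS: "T \<subseteq> S"
  have "wt T - wt S = root_comb (\<lambda>i. of_nat (of_bool (i \<in> S \<and> i \<notin> T)))"
    unfolding wt_diff[OF assms]
  proof (rule root_comb_cong)
    fix i
    show "of_bool (i \<in> S) - of_bool (i \<in> T) = (of_nat (of_bool (i \<in> S \<and> i \<notin> T)) :: complex)"
      using TS by (cases "i \<in> T"; cases "i \<in> S") auto
  qed
  then show "wt S \<sqsubseteq>\<^bsub>dominance_order r simple_root D\<^esub> wt T"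
    by (rule leI[where k = "\<lambda>i. of_bool (i \<in> S \<and> i \<notin> T)"])
qed

lemma wt_eq_iff:
  assumes "S \<subseteq> {..r}" "T \<subseteq> {..r}"
  shows "wt S = wt T \<longleftrightarrow> S = T"
  using wt_le_iff[OF assms] wt_le_iff[OF assms(2,1)] wt_le_iff[OF assms(1,1)] by auto

lemma wt_coroot:
  assumes "i \<le> r" "S \<subseteq> {..r}"
  shows "wt S (simple_coroot i) = of_int (int (dynkin_label i) - 2 * of_bool (i \<in> S)
    + of_bool (cyc_succ r i \<in> S) + of_bool (cyc_pred r i \<in> S))"
proof -
  have "highest_root simple_root S (simple_coroot i) = (\<Sum>j\<in>S. simple_root j (simple_coroot i))"
    unfolding highest_root_def using assms finite_subset[of S "{..r}"]
    by (simp add: sum_fun_apply)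
  also have "\<dots> = (\<Sum>j\<in>S. of_int (cartan_A1 r i j))"
    by (rule sum.cong) (use assms pairing in auto)
  also have "\<dots> = of_int (\<Sum>j\<in>S. cartan_A1 r i j)" by simp
  finally show ?thesis
    using dynkin_label[OF assms(1)] sum_cartan_A1[OF r_pos assms] by simp
qed

lemma wt_linear:
  assumes "S \<subseteq> {..r}" shows "Vector_Spaces.linear scale (*) (wt S)"
proof -
  interpret vs2: vector_space_pair scale "(*) :: complex \<Rightarrow> complex \<Rightarrow> complex"
    by (unfold_locales) (auto simp: algebra_simps)
  have "Vector_Spaces.linear scale (*) (\<lambda>h. \<Sum>i\<in>S. simple_root i h)"
    by (rule vs2.linear_compose_sum) (use assms roots_linear in auto)
  moreover have "Vector_Spaces.linear scale (*) \<Lambda>" using dominant by (simp add: dominant_weights_def)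
  ultimately have "Vector_Spaces.linear scale (*) (\<lambda>h. \<Lambda> h - (\<Sum>i\<in>S. simple_root i h))"
    by (intro vs2.linear_compose_sub)
  moreover have "wt S = (\<lambda>h. \<Lambda> h - (\<Sum>i\<in>S. simple_root i h))"
    by (simp add: fun_eq_iff highest_root_def sum_fun_apply)
  ultimately show ?thesis by simp
qed

text \<open>Off \<open>S\<close> the label is only increased by neighbours in \<open>S\<close>, so
  dominance imposes conditions at vertices of \<open>S\<close> alone, and these are the ones in
  \<open>good\<close>.\<close>

lemma wt_dominant_iff:
  assumes "S \<subseteq> {..r}"
  shows "wt S \<in> dominant_weights scale r simple_coroot \<longleftrightarrow> good S"
proof -
  have nat: "(of_int z :: complex) \<in> \<nat> \<longleftrightarrow> 0 \<le> z" for z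
    by (metis Nats_cases of_int_0_le_iff of_int_eq_iff of_int_of_nat_eq of_nat_0_le_iff of_nat_in_Nats zero_le_imp_eq_int)
  have "wt S (simple_coroot i) \<in> \<nat> \<longleftrightarrow>
     (i \<in> S \<longrightarrow> 2 \<le> dynkin_label i + of_bool (cyc_succ r i \<in> S) + of_bool (cyc_pred r i \<in> S))"
    if "i \<le> r" for i
    unfolding wt_coroot[OF that assms] nat by (auto simp: of_bool_def)
  then show ?thesis
    unfolding dominant_weights_def good_def using assms wt_linear[OF assms] by auto
qed

text \<open>Rows of the Cartan matrix sum to 0 and the matrix is symmetric, so simple roots vanish
  on the central element and the level is preserved.\<close>

lemma wt_central:
  assumes "S \<subseteq> {..r}"
  shows "wt S (central_element r simple_coroot) = \<Lambda> (central_element r simple_coroot)"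
proof -
  have lin: "f (central_element r simple_coroot) = (\<Sum>i\<le>r. f (simple_coroot i))"
    if "Vector_Spaces.linear scale (*) f" for f :: "'a \<Rightarrow> complex"
  proof -
    interpret f: Vector_Spaces.linear scale "(*)" f by (rule that)
    show ?thesis by (simp add: central_element_def f.sum)
  qed
  have 0: "simple_root j (central_element r simple_coroot) = 0" if "j \<le> r" for j
  proof -
    have "simple_root j (central_element r simple_coroot) = (\<Sum>i\<le>r. simple_root j (simple_coroot i))"
      by (rule lin[OF roots_linear[OF that]])
    also have "\<dots> = (\<Sum>i\<le>r. of_int (cartan_A1 r j i))"
      by (rule sum.cong) (use pairing that cartan_A1_sym in auto)
    also have "\<dots> = of_int (\<Sum>i\<le>r. cartan_A1 r j i)" by simp
    also have "\<dots> = 0" using sum_cartan_A1[OF r_pos that order.refl] cyc_in[OF that] that by simp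
    finally show ?thesis .
  qed
  have "highest_root simple_root S (central_element r simple_coroot) =
     (\<Sum>j\<in>S. simple_root j (central_element r simple_coroot))"
    by (simp add: highest_root_def sum_fun_apply)
  also have "\<dots> = 0" by (rule sum.neutral) (use 0 assms in auto)
  finally show ?thesis by simp
qed

lemma wt_empty: "wt {} = \<Lambda>"
  by (simp add: highest_root_def)

lemma lless_iff:
  "x \<sqsubset>\<^bsub>dominance_order r simple_root D\<^esub> y \<longleftrightarrow> x \<sqsubseteq>\<^bsub>dominance_order r simple_root D\<^esub> y \<and> x \<noteq> y"
  by (simp add: lless_def) (simp add: dominance_order_def)

lemma wt_lless_iff:
  assumes "S \<subseteq> {..r}" "T \<subseteq> {..r}"
  shows "wt S \<sqsubset>\<^bsub>dominance_order r simple_root D\<^esub> wt T \<longleftrightarrow> T \<subset> S"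
  using assms by (auto simp: lless_iff wt_le_iff wt_eq_iff)

section \<open>Cocovers, meets and intervals in terms of good sets\<close>

lemma minimal_good_if_covers:
  assumes K: "K \<subseteq> {..r}" and level: "\<Lambda> \<in> dominant_weights_level scale r simple_coroot m"
    and cov: "covers (dominance_order r simple_root (dominant_weights_level scale r simple_coroot m)) \<Lambda> (wt K)"
  shows "minimal_good K"
proof -
  let ?D = "dominant_weights_level scale r simple_coroot m"
  have mem: "wt S \<in> ?D \<longleftrightarrow> good S" if "S \<subseteq> {..r}" for S
    using wt_dominant_iff[OF that] wt_central[OF that] level by (simp add: dominant_weights_level_def)
  have c: "wt K \<in> ?D" "wt K \<sqsubset>\<^bsub>dominance_order r simple_root ?D\<^esub> wt {}"
    and nc: "\<And>z. z \<in> ?D \<Longrightarrow> wt K \<sqsubset>\<^bsub>dominance_order r simple_root ?D\<^esub> z \<Longrightarrow>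
        \<not> z \<sqsubset>\<^bsub>dominance_order r simple_root ?D\<^esub> wt {}"
    using cov unfolding covers_def wt_empty by (auto simp: dominance_order_def)
  \<comment> \<open>A good set strictly between \<open>{}\<close> and \<open>K\<close> would give a
    weight of the same level strictly between \<open>\<Lambda>\<close> and
    \<open>wt K\<close>.\<close>
  have "S = K" if S: "good S" "S \<subseteq> K" "S \<noteq> {}" for S
  proof (rule ccontr)
    assume "S \<noteq> K"
    then have "wt K \<sqsubset>\<^bsub>dominance_order r simple_root ?D\<^esub> wt S" "wt S \<sqsubset>\<^bsub>dominance_order r simple_root ?D\<^esub> wt {}"
      using S K by (subst wt_lless_iff; auto)+
    then show False using nc mem S K by (meson subset_trans)
  qed
  moreover have "K \<noteq> {}" using c(2) wt_lless_iff[OF K, of "{}"] by auto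
  ultimately show ?thesis using c(1) mem[OF K] by (simp add: minimal_good_def)
qed

text \<open>The union is good, and the coefficients of \<open>\<Lambda> - z\<close> for a lower
  bound \<open>z\<close> dominate the indicators of both \<open>K\<close> and \<open>K'\<close>,
  hence that of their union.\<close>

lemma meet_wt:
  assumes good: "good K" "good K'"
  shows "wt K \<sqinter>\<^bsub>dominance_order r simple_root (dominant_weights scale r simple_coroot)\<^esub> wt K' = wt (K \<union> K')"
proof -
  let ?P = "dominance_order r simple_root (dominant_weights scale r simple_coroot)"
  have V: "K \<subseteq> {..r}" "K' \<subseteq> {..r}" "K \<union> K' \<subseteq> {..r}" using good good_subset by auto
  have carrier: "carrier ?P = dominant_weights scale r simple_coroot" by (simp add: dominance_order_def)
  have mem: "wt K \<in> carrier ?P" "wt K' \<in> carrier ?P" "wt (K \<union> K') \<in> carrier ?P"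
    unfolding carrier wt_dominant_iff[OF V(1)] wt_dominant_iff[OF V(2)] wt_dominant_iff[OF V(3)]
    using good good_Un[OF good] by blast+
  have Low: "z \<in> Lower ?P {wt K, wt K'} \<longleftrightarrow> z \<in> carrier ?P \<and> z \<sqsubseteq>\<^bsub>?P\<^esub> wt K \<and> z \<sqsubseteq>\<^bsub>?P\<^esub> wt K'" for z
    using mem(1,2) unfolding Lower_def by blast
  have great: "greatest ?P (wt (K \<union> K')) (Lower ?P {wt K, wt K'})"
    unfolding greatest_def
  proof (intro conjI ballI)
    show "wt (K \<union> K') \<in> Lower ?P {wt K, wt K'}"
      unfolding Low wt_le_iff[OF V(3,1)] wt_le_iff[OF V(3,2)] using mem(3) by blast
    fix z assume "z \<in> Lower ?P {wt K, wt K'}"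
    then have z: "z \<sqsubseteq>\<^bsub>?P\<^esub> wt K" "z \<sqsubseteq>\<^bsub>?P\<^esub> wt K'" unfolding Low by blast+
    obtain k where k: "wt K - z = root_comb (\<lambda>i. of_nat (k i))" by (rule leE[OF z(1)])
    obtain l where l: "wt K' - z = root_comb (\<lambda>i. of_nat (l i))" by (rule leE[OF z(2)])
    have "wt K - wt K' = (wt K - z) - (wt K' - z)" by simp
    also have "\<dots> = root_comb (\<lambda>i. of_nat (k i) - of_nat (l i))"
      unfolding k l root_comb_diff ..
    finally have "root_comb (\<lambda>i. of_bool (i \<in> K') - of_bool (i \<in> K)) =
        root_comb (\<lambda>i. of_nat (k i) - of_nat (l i))"
      unfolding wt_diff[OF V(2,1)] .
    note kl = root_comb_eqD[OF this]
    \<comment> \<open>The coefficients of \<open>wt (K \<union> K') - z\<close>. Truncated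
      subtraction is harmless, since \<open>k i = l i + 1\<close> wherever 1 is subtracted.\<close>
    define n where "n i = k i - of_bool (i \<in> K' \<and> i \<notin> K)" for i
    have n: "of_nat (n i) = (of_nat (k i) - of_bool (i \<in> K' \<and> i \<notin> K) :: complex)" if "i \<le> r" for i
    proof (cases "i \<in> K' \<and> i \<notin> K")
      case True
      then have "of_nat (k i) - of_nat (l i) = (1 :: complex)" using kl[OF that] by simp
      then have "of_nat (k i) = (of_nat (l i + 1) :: complex)" by (simp add: diff_eq_eq)
      then have "k i = l i + 1" unfolding of_nat_eq_iff .
      then show ?thesis using True by (simp add: n_def)
    qed (auto simp: n_def)
    have "wt (K \<union> K') - z = (wt K - z) - (wt K - wt (K \<union> K'))" by simp
    also have "\<dots> = root_comb (\<lambda>i. of_nat (k i) - (of_bool (i \<in> K \<union> K') - of_bool (i \<in> K)))"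
      unfolding k wt_diff[OF V(3,1)] root_comb_diff ..
    also have "\<dots> = root_comb (\<lambda>i. of_nat (n i))"
    proof (rule root_comb_cong)
      fix i assume "i \<le> r"
      show "of_nat (k i) - (of_bool (i \<in> K \<union> K') - of_bool (i \<in> K)) = (of_nat (n i) :: complex)"
        unfolding n[OF \<open>i \<le> r\<close>] by (cases "i \<in> K"; cases "i \<in> K'") simp_all
    qed
    finally show "z \<sqsubseteq>\<^bsub>?P\<^esub> wt (K \<union> K')" by (rule leI)
  qed (rule Lower_closed)
  note greatest1 = conjunct1[OF conjunct2[OF greatest_def[THEN iffD1]]]
    and greatest2 = bspec[OF conjunct2[OF conjunct2[OF greatest_def[THEN iffD1]]]]
  \<comment> \<open>The meet is defined by choice, so the greatest lower bound has to be shown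
    unique.\<close>
  have uniq: "z = wt (K \<union> K')" if "greatest ?P z (Lower ?P {wt K, wt K'})" for z
  proof (rule le_antisym)
    show "z \<sqsubseteq>\<^bsub>?P\<^esub> wt (K \<union> K')"
      by (rule greatest2[OF great greatest1[OF that]])
    show "wt (K \<union> K') \<sqsubseteq>\<^bsub>?P\<^esub> z"
      by (rule greatest2[OF that greatest1[OF great]])
  qed
  show ?thesis unfolding meet_def inf_def
    by (rule some_equality[where P = "\<lambda>x. greatest ?P x (Lower ?P {wt K, wt K'})", OF great uniq])
qed

lemma interval_wt:
  assumes "good U"
  shows "\<lbrace>wt U..\<Lambda>\<rbrace>\<^bsub>dominance_order r simple_root (dominant_weights scale r simple_coroot)\<^esub> =
    wt ` {S. good S \<and> S \<subseteq> U}"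
proof -
  let ?P = "dominance_order r simple_root (dominant_weights scale r simple_coroot)"
  have U: "U \<subseteq> {..r}" using assms good_subset by auto
  have carrier: "carrier ?P = dominant_weights scale r simple_coroot" by (simp add: dominance_order_def)
  have "x \<in> wt ` {S. good S \<and> S \<subseteq> U}"
    if x: "x \<in> carrier ?P" "wt U \<sqsubseteq>\<^bsub>?P\<^esub> x" "x \<sqsubseteq>\<^bsub>?P\<^esub> wt {}" for x
  proof -
    obtain k where k: "x - wt U = root_comb (\<lambda>i. of_nat (k i))" by (rule leE[OF x(2)])
    obtain l where l: "wt {} - x = root_comb (\<lambda>i. of_nat (l i))" by (rule leE[OF x(3)])
    have "wt {} - wt U = (x - wt U) + (wt {} - x)" by simp
    also have "\<dots> = root_comb (\<lambda>i. of_nat (k i) + of_nat (l i))"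
      unfolding k l root_comb_add ..
    finally have "root_comb (\<lambda>i. of_bool (i \<in> U) - of_bool (i \<in> {})) =
        root_comb (\<lambda>i. of_nat (k i) + of_nat (l i))"
      unfolding wt_diff[OF U empty_subsetI] .
    from root_comb_eqD[OF this]
    have "of_nat (of_bool (i \<in> U)) = (of_nat (k i + l i) :: complex)" if "i \<le> r" for i
      using that by simp
    then have kl: "of_bool (i \<in> U) = k i + l i" if "i \<le> r" for i
      using that of_nat_eq_iff by blast
    \<comment> \<open>The coefficients \<open>l\<close> of \<open>\<Lambda> - x\<close> and
      \<open>k\<close> of \<open>x - wt U\<close> add up to the indicator of \<open>U\<close>; hence
      \<open>l\<close> is itself the indicator of a subset of \<open>U\<close>.\<close>
    define S where "S = {i. i \<le> r \<and> l i = 1}"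
    have S: "S \<subseteq> U" "S \<subseteq> {..r}"
    proof
      fix i assume "i \<in> S"
      then show "i \<in> U" using kl[of i] by (cases "i \<in> U") (auto simp: S_def)
    qed (auto simp: S_def)
    have "wt {} - x = root_comb (\<lambda>i. of_bool (i \<in> S) - of_bool (i \<in> {}))"
      unfolding l
    proof (rule root_comb_cong)
      fix i assume "i \<le> r"
      then have "l i = 0 \<or> l i = 1" using kl[of i] by (cases "i \<in> U") auto
      then show "of_nat (l i) = (of_bool (i \<in> S) - of_bool (i \<in> {}) :: complex)"
        using \<open>i \<le> r\<close> by (auto simp: S_def)
    qed
    also have "\<dots> = wt {} - wt S" by (rule wt_diff[OF S(2) empty_subsetI, symmetric])
    finally have "wt {} - x = wt {} - wt S" .
    moreover have "y = z" if "w - y = w - z" for w y z :: "'a \<Rightarrow> complex"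
      using that by simp
    ultimately have "x = wt S" by blast
    then show ?thesis using x(1) S wt_dominant_iff[OF S(2)] carrier by auto
  qed
  moreover have "x \<in> carrier ?P \<and> wt U \<sqsubseteq>\<^bsub>?P\<^esub> x \<and> x \<sqsubseteq>\<^bsub>?P\<^esub> wt {}"
    if "x \<in> wt ` {S. good S \<and> S \<subseteq> U}" for x
    using that wt_dominant_iff wt_le_iff U carrier good_subset by auto
  ultimately show ?thesis unfolding at_least_at_most_def wt_empty by blast
qed

text \<open>On these sets \<open>wt\<close> is injective and reverses the order, so intermediate
  elements correspond.\<close>

lemma hasse_diagram_wt:
  assumes "F \<subseteq> Pow {..r}"
  shows "hasse_diagram (dominance_order r simple_root (wt ` F)) = map_prod wt wt ` covering_pairs F"
proof -
  let ?L = "dominance_order r simple_root (wt ` F)"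
  have carrier: "carrier ?L = wt ` F" by (simp add: dominance_order_def)
  have lless: "wt S \<sqsubset>\<^bsub>?L\<^esub> wt T \<longleftrightarrow> T \<subset> S" if "S \<in> F" "T \<in> F" for S T
    by (rule wt_lless_iff) (use assms that in auto)
  have covers: "covers ?L (wt S) (wt T) \<longleftrightarrow> (S, T) \<in> covering_pairs F" if ST: "S \<in> F" "T \<in> F" for S T
  proof -
    have "(\<exists>z\<in>wt ` F. wt T \<sqsubset>\<^bsub>?L\<^esub> z \<and> z \<sqsubset>\<^bsub>?L\<^esub> wt S) \<longleftrightarrow> (\<exists>Z\<in>F. S \<subset> Z \<and> Z \<subset> T)"
      unfolding bex_simps
      by (rule bex_cong[OF refl], unfold lless[OF ST(2)] lless[OF _ ST(1)]) (rule conj_commute)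
    then show ?thesis
      unfolding covers_def covering_pairs_def carrier lless[OF ST(2,1)] using ST by simp
  qed
  show ?thesis
  proof (intro subset_antisym subrelI)
    fix x y assume "(x, y) \<in> hasse_diagram ?L"
    then have xy: "covers ?L x y" by (simp add: hasse_diagram_def)
    then obtain S T where ST: "S \<in> F" "T \<in> F" "x = wt S" "y = wt T"
      unfolding covers_def carrier by blast
    then have "(S, T) \<in> covering_pairs F" using xy covers[OF ST(1,2)] by simp
    then show "(x, y) \<in> map_prod wt wt ` covering_pairs F"
      unfolding ST(3,4) by (rule map_prod_imageI)
  next
    fix x y assume "(x, y) \<in> map_prod wt wt ` covering_pairs F"
    then obtain S T where ST: "(S, T) \<in> covering_pairs F" "x = wt S" "y = wt T"
      by (elim imageE) (metis map_prod_simp prod.exhaust Pair_inject)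
    then have "S \<in> F" "T \<in> F" by (simp_all add: covering_pairs_def)
    then show "(x, y) \<in> hasse_diagram ?L"
      unfolding hasse_diagram_def ST(2,3) using covers ST(1) by simp
  qed
qed

lemma card_wt:
  assumes "F \<subseteq> Pow {..r}"
  shows "card (wt ` F) = card F"
  by (rule card_image, rule inj_onI) (use assms wt_eq_iff in blast)

end

section \<open>Intervals between a weight and the meet of two cocovers\<close>

text \<open>The hypothesis \<open>not_wrapping\<close> guards against far ends that become adjacent
  around the cycle and form an additional good set. For \<open>r = 2\<close> with all labels 1,
  \<open>K = {0, 1}\<close> and \<open>K' = {1, 2}\<close>, the set \<open>{0, 2}\<close> is also
  good and the interval is no diamond. Case (2) with the roles of \<open>K\<close> and
  \<open>K'\<close> exchanged is the same statement for the exchanged cocovers.\<close>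

theorem theorem3:
  fixes scale :: "complex \<Rightarrow> 'h::ab_group_add \<Rightarrow> 'h"
    and r m :: nat
    and simple_coroot :: "nat \<Rightarrow> 'h"
    and simple_root :: "nat \<Rightarrow> 'h \<Rightarrow> complex"
    and \<Lambda> \<mu> \<mu>' :: "'h \<Rightarrow> complex"
    and K K' :: "nat set"
  defines "P \<equiv> dominance_order r simple_root (dominant_weights scale r simple_coroot)"
    and "Pm \<equiv> dominance_order r simple_root (dominant_weights_level scale r simple_coroot m)"
  defines "\<omega> \<equiv> \<mu> \<sqinter>\<^bsub>P\<^esub> \<mu>'"
  defines "X \<equiv> \<lbrace>\<omega>..\<Lambda>\<rbrace>\<^bsub>P\<^esub>"
  defines "H \<equiv> hasse_diagram (dominance_order r simple_root X)"
  assumes realization: "realization_A1 scale r simple_coroot simple_root"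
    and r: "r \<ge> 1"
    and m: "m > 0"
    and \<Lambda>: "\<Lambda> \<in> dominant_weights_level scale r simple_coroot m"
    and K: "connected_subdiagram r K" "K \<noteq> {..r}"
    and K': "connected_subdiagram r K'" "K' \<noteq> {..r}"
    and \<mu>: "\<mu> = \<Lambda> - highest_root simple_root K" "covers Pm \<Lambda> \<mu>"
    and \<mu>': "\<mu>' = \<Lambda> - highest_root simple_root K'" "covers Pm \<Lambda> \<mu>'"
    and distinct_cocovers: "\<mu> \<noteq> \<mu>'"
    and not_wrapping:
      "K \<union> K' = {..r} \<longrightarrow> (card K = 1 \<and> card K' = 1) \<or> card (K \<inter> K') \<ge> 2"
  shows
    "((card K = 1 \<and> card K' = 1)
        \<or> \<not> connected_subdiagram r (K \<union> K')
        \<or> (connected_subdiagram r (K \<union> K') \<and> K \<inter> K' \<noteq> {}) \<longrightarrow>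
       X = {\<Lambda>, \<mu>, \<mu>', \<omega>} \<and> card X = 4 \<and>
       H = {(\<Lambda>, \<mu>), (\<Lambda>, \<mu>'), (\<mu>, \<omega>), (\<mu>', \<omega>)})
     \<and>
     (connected_subdiagram r (K \<union> K') \<and> K \<inter> K' = {} \<and> card K = 1 \<and> card K' > 1 \<longrightarrow>
       (\<exists>\<nu>. X = {\<Lambda>, \<mu>, \<nu>, \<mu>', \<omega>} \<and> card X = 5 \<and>
         H = {(\<Lambda>, \<mu>), (\<mu>, \<nu>), (\<nu>, \<omega>), (\<Lambda>, \<mu>'), (\<mu>', \<omega>)}))
     \<and>
     (connected_subdiagram r (K \<union> K') \<and> K \<inter> K' = {} \<and> card K > 1 \<and> card K' > 1 \<longrightarrow>
       (\<exists>\<kappa> \<nu> \<nu>'. X = {\<Lambda>, \<mu>, \<mu>', \<kappa>, \<nu>, \<nu>', \<omega>} \<and> card X = 7 \<and>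
         H = {(\<Lambda>, \<mu>), (\<Lambda>, \<kappa>), (\<Lambda>, \<mu>'), (\<mu>, \<nu>), (\<kappa>, \<nu>), (\<kappa>, \<nu>'), (\<mu>', \<nu>'),
              (\<nu>, \<omega>), (\<nu>', \<omega>)}))"
proof -
  have dom: "\<Lambda> \<in> dominant_weights scale r simple_coroot"
    using \<Lambda> by (simp add: dominant_weights_level_def)
  interpret D: dominant_weight scale r simple_coroot simple_root \<Lambda>
    by (intro dominant_weight.intro dominant_weight_axioms.intro realization r dom)
  define W where "W S = \<Lambda> - highest_root simple_root S" for S
  define F where "F = {S. D.good S \<and> S \<subseteq> K \<union> K'}"
  have V: "K \<subseteq> {..r}" "K' \<subseteq> {..r}" using K K' by (auto simp: connected_subdiagram_def)
  have mK: "D.minimal_good K"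
    using D.minimal_good_if_covers[OF V(1) \<Lambda>] \<mu>(2) unfolding \<mu>(1) Pm_def .
  have mK': "D.minimal_good K'"
    using D.minimal_good_if_covers[OF V(2) \<Lambda>] \<mu>'(2) unfolding \<mu>'(1) Pm_def .
  note gK = D.minimal_good_is_good[OF mK] D.minimal_good_is_good[OF mK']
  note gU = D.good_Un[OF gK]
  have neq: "K \<noteq> K'" using distinct_cocovers unfolding \<mu>(1) \<mu>'(1) by blast
  have nsub: "\<not> K \<subseteq> K'" "\<not> K' \<subseteq> K"
    using D.minimal_good_not_subset[OF mK mK' neq] D.minimal_good_not_subset[OF mK' mK] neq by blast+
  have ne: "K \<noteq> {}" "K' \<noteq> {}" using mK mK' by (simp_all add: D.minimal_good_def)
  have \<omega>: "\<omega> = W (K \<union> K')"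
    unfolding \<omega>_def P_def \<mu>(1) \<mu>'(1) W_def by (rule D.meet_wt[OF gK])
  have W: "W {} = \<Lambda>" "W K = \<mu>" "W K' = \<mu>'" "W (K \<union> K') = \<omega>"
    using D.wt_empty \<omega> by (simp_all add: W_def \<mu>(1) \<mu>'(1))
  have W_abs: "(\<lambda>S. \<Lambda> - highest_root simple_root S) = W" by (simp add: W_def fun_eq_iff)
  have FV: "F \<subseteq> Pow {..r}" unfolding F_def using V by blast
  have X: "X = W ` F"
    unfolding X_def \<omega> P_def F_def W_abs[symmetric] by (rule D.interval_wt[OF gU])
  have H: "H = map_prod W W ` covering_pairs F"
    unfolding H_def X W_abs[symmetric] by (rule D.hasse_diagram_wt[OF FV])
  have cardX: "card X = card F"
    unfolding X W_abs[symmetric] by (rule D.card_wt[OF FV])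
  have adj: "D.adj x y \<longleftrightarrow> (x, y) \<in> dynkin_edges r" if "x \<le> r" "y \<le> r" for x y
    unfolding dynkin_edges_cyc[OF r] D.adj_def using that by blast
  have conn: "connected_subdiagram r (K \<union> K') \<longleftrightarrow> (\<exists>x\<in>K. \<exists>y\<in>K'. x = y \<or> D.adj x y)"
    unfolding connected_subdiagram_Un_iff[OF K(1) K'(1)]
    using adj V by (meson atMost_iff subset_iff)
  show ?thesis
  proof (intro conjI[of "_ \<longrightarrow> _"] impI)
    assume c: "(card K = 1 \<and> card K' = 1) \<or> \<not> connected_subdiagram r (K \<union> K')
        \<or> (connected_subdiagram r (K \<union> K') \<and> K \<inter> K' \<noteq> {})"
    have F: "F = {{}, K, K', K \<union> K'}"
    proof -
      consider "card K = 1 \<and> card K' = 1" | "\<not> connected_subdiagram r (K \<union> K')"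
        | "\<not> (card K = 1 \<and> card K' = 1)" "K \<inter> K' \<noteq> {}"
        using c by blast
      then show ?thesis
      proof cases
        case 1
        then obtain i j where "K = {i}" "K' = {j}" by (meson card_1_singletonE)
        then show ?thesis using D.good_subsets_singletons[of i j] gK by (simp add: F_def)
      next
        case 2
        then have "K \<inter> K' = {}" "\<And>x y. x \<in> K \<Longrightarrow> y \<in> K' \<Longrightarrow> \<not> D.adj x y"
          unfolding conn by blast+
        then show ?thesis unfolding F_def by (rule D.good_subsets_nonadjacent[OF mK mK'])
      next
        case 3
        \<comment> \<open>The two diagrams are not both singletons here, which leaves only the
          second alternative of \<open>not_wrapping\<close>.\<close>
        have "2 \<le> card (K \<inter> K')" if "K \<union> K' = {..r}"
          using mp[OF not_wrapping that] 3(1) by (elim disjE) simp_all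
        then show ?thesis unfolding F_def
          by (rule D.good_subsets_overlap[OF mK K(2) mK' K'(2) neq 3(2)])
      qed
    qed
    have diamond: "{} \<subset> K" "{} \<subset> K'" "K \<subset> K \<union> K'" "K' \<subset> K \<union> K'" using nsub ne by blast+
    note D4 = covering_pairs_diamond[OF diamond nsub]
    show "X = {\<Lambda>, \<mu>, \<mu>', \<omega>} \<and> card X = 4 \<and>
       H = {(\<Lambda>, \<mu>), (\<Lambda>, \<mu>'), (\<mu>, \<omega>), (\<mu>', \<omega>)}"
      unfolding cardX H unfolding X F D4 by (simp add: W)
  next
    assume c: "connected_subdiagram r (K \<union> K') \<and> K \<inter> K' = {} \<and> card K = 1 \<and> card K' > 1"
    then obtain i where i: "K = {i}" by (meson card_1_singletonE)
    have K'1: "K' \<noteq> {j}" for j using c by auto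
    obtain y where y: "y \<in> K'" "D.adj i y" using c i unfolding conn by blast
    have "i \<notin> K'" using c i by blast
    \<comment> \<open>The diagrams are disjoint and \<open>K'\<close> is no singleton, so both
      alternatives of \<open>not_wrapping\<close> fail.\<close>
    have "insert i K' \<noteq> {..r}" using not_wrapping c i by auto
    then obtain e e' where e: "e \<in> K'" "e' \<in> K'" "e \<noteq> e'"
      and F': "{S. D.good S \<and> S \<subseteq> insert i K'} = {{}, {i}, {i, e}, K', insert i K'}"
      by (rule D.good_subsets_adjacent_singleton[OF mK[unfolded i] mK' K'(2) K'1 \<open>i \<notin> K'\<close> y])
    have F: "F = {{}, {i}, {i, e}, K', insert i K'}" using F' by (simp add: F_def i)
    have ei: "e \<noteq> i" "e' \<noteq> i" using e \<open>i \<notin> K'\<close> by blast+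
    have inc: "\<not> {i} \<subseteq> K'" "\<not> K' \<subseteq> {i, e}" using e ei \<open>i \<notin> K'\<close> by blast+
    have "{} \<subset> {i}" "{i} \<subset> {i, e}" "{i, e} \<subset> insert i K'" "{} \<subset> K'" "K' \<subset> insert i K'"
      unfolding psubset_eq using inc ei e by (simp_all, blast+)
    note D5 = covering_pairs_pentagon[OF this inc]
    show "\<exists>\<nu>. X = {\<Lambda>, \<mu>, \<nu>, \<mu>', \<omega>} \<and> card X = 5 \<and>
         H = {(\<Lambda>, \<mu>), (\<mu>, \<nu>), (\<nu>, \<omega>), (\<Lambda>, \<mu>'), (\<mu>', \<omega>)}"
    proof
      \<comment> \<open>The element \<open>\<nu>\<close> is \<open>\<mu>\<close> minus the simple
        root at \<open>e\<close>.\<close>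
      have "W {i} = \<mu>" "W (insert i K') = \<omega>" using W(2,4) by (simp_all add: i)
      then show "X = {\<Lambda>, \<mu>, W {i, e}, \<mu>', \<omega>} \<and> card X = 5 \<and>
         H = {(\<Lambda>, \<mu>), (\<mu>, W {i, e}), (W {i, e}, \<omega>), (\<Lambda>, \<mu>'), (\<mu>', \<omega>)}"
        unfolding cardX H unfolding X F D5 by (simp add: W)
    qed
  next
    assume c: "connected_subdiagram r (K \<union> K') \<and> K \<inter> K' = {} \<and> card K > 1 \<and> card K' > 1"
    have K1: "K \<noteq> {j}" and K'1: "K' \<noteq> {j}" for j using c by auto
    obtain x y where xy: "x \<in> K" "y \<in> K'" "D.adj x y" using c unfolding conn by blast
    have disj: "K \<inter> K' = {}" using c by blast
    have "K \<union> K' \<noteq> {..r}" using not_wrapping c by auto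
    then obtain e f e' f' where e: "e \<in> K" "f \<in> K" "e \<noteq> f" "e' \<in> K'" "f' \<in> K'" "e' \<noteq> f'"
      and F: "F = {{}, K, K', {e, e'}, insert e' K, insert e K', K \<union> K'}"
      unfolding F_def
      by (rule D.good_subsets_adjacent[OF mK K(2) K1 mK' K'(2) K'1 disj xy])
    have nin: "e \<notin> K'" "f \<notin> K'" "e' \<notin> K" "f' \<notin> K" using e disj by blast+
    then have nin': "f \<noteq> e'" "f' \<noteq> e" using e by metis+
    \<comment> \<open>The second vertices \<open>f\<close> and \<open>f'\<close> of the arcs serve
      as witnesses that the inclusions are strict.\<close>
    have strict: "A \<subset> B" if "A \<subseteq> B" "x \<in> B" "x \<notin> A" for A B :: "nat set" and x
      using that by blast
    have bot: "{} \<subset> K" "{} \<subset> {e, e'}" "{} \<subset> K'"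
      using ne by blast+
    have b1: "K \<subset> insert e' K" by (rule strict[of _ _ e']) (use e nin nin' in auto)
    have b2: "{e, e'} \<subset> insert e' K" by (rule strict[of _ _ f]) (use e nin nin' in auto)
    have b3: "{e, e'} \<subset> insert e K'" by (rule strict[of _ _ f']) (use e nin nin' in auto)
    have b4: "K' \<subset> insert e K'" by (rule strict[of _ _ e]) (use e nin nin' in auto)
    have b5: "insert e' K \<subset> K \<union> K'" by (rule strict[of _ _ f']) (use e nin nin' in auto)
    have b6: "insert e K' \<subset> K \<union> K'" by (rule strict[of _ _ f]) (use e nin nin' in auto)
    have inc: "\<not> K \<subseteq> insert e K'" "\<not> K' \<subseteq> insert e' K" "\<not> {e, e'} \<subseteq> K" "\<not> {e, e'} \<subseteq> K'"
      using e nin by auto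
    note D7 = covering_pairs_seven[OF bot b1 b2 b3 b4 b5 b6 inc]
    \<comment> \<open>Here \<open>\<kappa>\<close> subtracts from \<open>\<Lambda>\<close> the
      simple roots at \<open>e\<close> and \<open>e'\<close>, while \<open>\<nu>\<close> is
      \<open>\<mu>\<close> minus the one at \<open>e'\<close> and \<open>\<nu>'\<close> is
      \<open>\<mu>'\<close> minus the one at \<open>e\<close>.\<close>
    show "\<exists>\<kappa> \<nu> \<nu>'. X = {\<Lambda>, \<mu>, \<mu>', \<kappa>, \<nu>, \<nu>', \<omega>} \<and> card X = 7 \<and>
         H = {(\<Lambda>, \<mu>), (\<Lambda>, \<kappa>), (\<Lambda>, \<mu>'), (\<mu>, \<nu>), (\<kappa>, \<nu>), (\<kappa>, \<nu>'), (\<mu>', \<nu>'),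
              (\<nu>, \<omega>), (\<nu>', \<omega>)}"
      unfolding cardX H unfolding X F D7
      by (rule exI[of _ "W {e, e'}"], rule exI[of _ "W (insert e' K)"],
          rule exI[of _ "W (insert e K')"]) (simp add: W)
  qed
qed

end
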